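(* Let $k$ be an algebraically closed field and let $f\in k[X_1,\ldots,X_n]$ be a polynomial admitting an isolated singularity at the origin of $\mathbb A^n_k$. Then the fibration $f\colon\mathbb A^n_k\to\mathbb A^1_k$ is a local smoothing (of the singularity at the origin) if and only if $\mu(f)<\infty$.
   Context: Let $R=k[[X_1,\ldots,X_n]]$ with maximal ideal $\mathfrak m$. For $f\in R$, $J(f)=\langle f_{X_1},\ldots,f_{X_n}\rangle$ is the ideal of partial derivatives, $\mu(f)=\dim_kR/J(f)\in\mathbb N\cup\{\infty\}$ is the Milnor number, and $\tau(f)=\dim_kR/(\langle f\rangle+J(f))$ is the Tjurina number. A polynomial $f$ has an isolated singularity at the origin if $f\in\mathfrak m^2$ and $\tau(f)<\infty$. (For polynomials, these numbers can equally be computed in the local ring $\mathcal O_{\mathbb A^n,0}$.) The fibration $f\colon\mathbb A^n\to\mathbb A^1$ is a local smoothing if there is a Zariski open neighborhood $U$ of the origin in $\mathbb A^n$ such that for every $s\in k$, $s\neq 0$, the fiber $\{f=s\}$ is smooth at all of its points in $U$ (a point $x$ with $f(x)=s$ is singular on the fiber iff $f_{X_i}(x)=0$ for all $i$). *)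

theory Defs
  imports
    "HOL-Library.Poly_Mapping"
    "HOL-Library.Extended_Nat"
    "HOL-Computational_Algebra.Computational_Algebra"
    "HOL-Algebra.Algebra"
    "HOL-Algebra.Algebraic_Closure_Type"
begin

text \<open>
  The variables are indexed by a finite type \<open>'n\<close>, so the number of variables is \<open>CARD('n)\<close>.
  A monomial is identified with its exponent vector.
\<close>

type_synonym 'n expo = "'n \<Rightarrow>\<^sub>0 nat"

type_synonym ('n, 'k) mpoly = "'n expo \<Rightarrow>\<^sub>0 'k"


section \<open>The formal power series ring in several variables\<close>

typedef ('n, 'k) mfps = "UNIV :: ('n expo \<Rightarrow> 'k) set"
  morphisms mfps_nth Abs_mfps
  by simp

lemma mfps_nth_Abs [simp]: "mfps_nth (Abs_mfps f) = f"
  by (simp add: Abs_mfps_inverse)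

lemma mfps_eqI: "(\<And>a. mfps_nth F a = mfps_nth G a) \<Longrightarrow> F = G"
  by (metis ext mfps_nth_inject)

lemma finite_expo_decomp: "finite {(a, b). a + b = (c :: 'n :: finite expo)}"
proof -
  have "finite {g :: 'n \<Rightarrow> nat. \<forall>i. g i \<in> {..Poly_Mapping.lookup c i}}"
  proof -
    have "{g :: 'n \<Rightarrow> nat. \<forall>i. g i \<in> {..Poly_Mapping.lookup c i}}
            = PiE UNIV (\<lambda>i. {..Poly_Mapping.lookup c i})"
      by (auto simp: PiE_def Pi_def extensional_def)
    thus ?thesis by (simp add: finite_PiE)
  qed
  moreover have "Poly_Mapping.lookup ` {a. \<exists>b. a + b = c}
            \<subseteq> {g. \<forall>i. g i \<in> {..Poly_Mapping.lookup c i}}"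
    by (auto simp: lookup_add)
  ultimately have "finite (Poly_Mapping.lookup ` {a. \<exists>b. a + b = c})"
    by (rule rev_finite_subset)
  hence fin: "finite {a. \<exists>b. a + b = c}"
    by (rule finite_imageD) (simp add: inj_on_def poly_mapping_eqI)
  have "{(a, b). a + b = c} \<subseteq> (\<lambda>a. (a, c - a)) ` {a. \<exists>b. a + b = c}"
    by auto
  thus ?thesis using fin by (meson finite_imageI finite_subset)
qed

instantiation mfps :: (finite, comm_ring_1) comm_ring_1
begin

definition zero_mfps_def: "0 = Abs_mfps (\<lambda>_. 0)"
definition one_mfps_def: "1 = Abs_mfps (\<lambda>a. if a = 0 then 1 else 0)"
definition plus_mfps_def: "F + G = Abs_mfps (\<lambda>a. mfps_nth F a + mfps_nth G a)"
definition uminus_mfps_def: "- F = Abs_mfps (\<lambda>a. - mfps_nth F a)"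
definition minus_mfps_def: "F - G = Abs_mfps (\<lambda>a. mfps_nth F a - mfps_nth G a)"
definition times_mfps_def:
  "F * G = Abs_mfps (\<lambda>c. \<Sum>(a, b) | a + b = c. mfps_nth F a * mfps_nth G b)"

instance
proof
  fix F G H :: "('a, 'b) mfps"
  note defs = zero_mfps_def one_mfps_def plus_mfps_def uminus_mfps_def minus_mfps_def
  show "F + G + H = F + (G + H)" "F + G = G + F" "0 + F = F" "- F + F = 0" "F - G = F + - G"
    by (simp_all add: defs algebra_simps mfps_nth_inverse)
  show "(0 :: ('a, 'b) mfps) \<noteq> 1"
    by (simp add: defs Abs_mfps_inject fun_eq_iff)
  show "F * G = G * F"
  proof (rule mfps_eqI)
    fix c
    have "(\<Sum>(a, b) | a + b = c. mfps_nth F a * mfps_nth G b)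
        = (\<Sum>(a, b) | a + b = c. mfps_nth G a * mfps_nth F b)"
      by (rule sum.reindex_bij_witness[of _ prod.swap prod.swap])
         (auto simp: add.commute mult.commute)
    thus "mfps_nth (F * G) c = mfps_nth (G * F) c" by (simp add: times_mfps_def)
  qed
  show "1 * F = F"
  proof (rule mfps_eqI)
    fix c
    have "mfps_nth (1 * F) c
        = (\<Sum>p | fst p + snd p = c. if p = (0, c) then mfps_nth F c else 0)"
      unfolding times_mfps_def one_mfps_def mfps_nth_Abs
    proof (rule sum.cong)
      fix p assume "p \<in> {p. fst p + snd p = c}"
      thus "(case p of (a, b) \<Rightarrow> (if a = 0 then 1 else 0) * mfps_nth F b)
          = (if p = (0, c) then mfps_nth F c else 0)"
        by (cases "fst p = 0") (simp_all add: case_prod_unfold prod_eq_iff)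
    qed (simp add: case_prod_unfold)
    also have "\<dots> = mfps_nth F c"
      using finite_expo_decomp[of c] by (subst sum.delta) (auto simp: case_prod_unfold)
    finally show "mfps_nth (1 * F) c = mfps_nth F c" .
  qed
  show "(F + G) * H = F * H + G * H"
    by (rule mfps_eqI)
       (simp add: times_mfps_def plus_mfps_def algebra_simps case_prod_unfold sum.distrib)
  show "F * G * H = F * (G * H)"
  proof (rule mfps_eqI)
    fix c
    let ?D = "\<lambda>c :: 'a expo. {(a, b). a + b = c}"
    let ?t = "\<lambda>a b e. mfps_nth F a * mfps_nth G b * mfps_nth H e"
    have "mfps_nth (F * G * H) c = (\<Sum>p\<in>?D c. \<Sum>q\<in>?D (fst p). ?t (fst q) (snd q) (snd p))"
      by (simp add: times_mfps_def case_prod_unfold sum_distrib_right)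
    also have "\<dots> = (\<Sum>(p, q)\<in>Sigma (?D c) (\<lambda>p. ?D (fst p)). ?t (fst q) (snd q) (snd p))"
      by (rule sum.Sigma) (auto intro: finite_expo_decomp)
    also have "\<dots> = (\<Sum>(p, q)\<in>Sigma (?D c) (\<lambda>p. ?D (snd p)). ?t (fst p) (fst q) (snd q))"
      by (rule sum.reindex_bij_witness[of _
            "\<lambda>(p, q). ((fst p + fst q, snd q), (fst p, fst q))"
            "\<lambda>(p, q). ((fst q, snd q + snd p), (snd q, snd p))"])
         (auto simp: add.assoc)
    also have "\<dots> = (\<Sum>p\<in>?D c. \<Sum>q\<in>?D (snd p). ?t (fst p) (fst q) (snd q))"
      by (rule sum.Sigma[symmetric]) (auto intro: finite_expo_decomp)
    also have "\<dots> = mfps_nth (F * (G * H)) c"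
      by (simp add: times_mfps_def case_prod_unfold sum_distrib_left mult.assoc)
    finally show "mfps_nth (F * G * H) c = mfps_nth (F * (G * H)) c" .
  qed
qed

end

definition mfps_const :: "'k \<Rightarrow> ('n :: finite, 'k :: comm_ring_1) mfps"
  where "mfps_const c = Abs_mfps (\<lambda>a. if a = 0 then c else 0)"

definition mfps_deriv :: "'n \<Rightarrow> ('n :: finite, 'k :: comm_ring_1) mfps \<Rightarrow> ('n, 'k) mfps"
  where "mfps_deriv i F = Abs_mfps (\<lambda>a.
           of_nat (Poly_Mapping.lookup a i + 1) * mfps_nth F (a + Poly_Mapping.single i 1))"

abbreviation mfps_ring :: "('n :: finite, 'k :: comm_ring_1) mfps ring"
  where "mfps_ring \<equiv> ring_of_type_algebra"

definition mfps_maximal_ideal :: "('n :: finite, 'k :: comm_ring_1) mfps set"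
  where "mfps_maximal_ideal = {F. mfps_nth F 0 = 0}"

lemma mfps_mult_nth_0: "mfps_nth (F * G) 0 = mfps_nth F 0 * mfps_nth G 0"
  for F G :: "('n :: finite, 'k :: comm_ring_1) mfps"
proof -
  have "a + b = 0 \<longleftrightarrow> a = 0 \<and> b = 0" for a b :: "'n expo"
    by (auto simp: poly_mapping_eq_iff fun_eq_iff plus_poly_mapping.rep_eq)
  hence "{(a, b). a + b = (0 :: 'n expo)} = {(0, 0)}" by auto
  thus ?thesis by (simp add: times_mfps_def)
qed

lemma maximalideal_mfps_maximal_ideal:
  "maximalideal (mfps_maximal_ideal :: ('n :: finite, 'k :: field) mfps set) mfps_ring"
proof -
  let ?R = "mfps_ring :: ('n, 'k) mfps ring"
  let ?m = "mfps_maximal_ideal :: ('n, 'k) mfps set"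
  interpret R: cring ?R by (rule cring_from_type_algebra)
  have R [simp]: "carrier ?R = UNIV" "a \<oplus>\<^bsub>?R\<^esub> b = a + b" "a \<otimes>\<^bsub>?R\<^esub> b = a * b" "\<one>\<^bsub>?R\<^esub> = 1" "\<zero>\<^bsub>?R\<^esub> = 0"
    for a b by (simp_all add: ring_of_type_algebra_def)
  have minus: "\<ominus>\<^bsub>?R\<^esub> a = - a" for a
    by (rule R.minus_equality) simp_all
  have nth: "mfps_nth (0 :: ('n, 'k) mfps) 0 = 0" "mfps_nth (1 :: ('n, 'k) mfps) 0 = 1"
    "mfps_nth (F + G) 0 = mfps_nth F 0 + mfps_nth G 0" "mfps_nth (- F) 0 = - mfps_nth F 0"
    "mfps_nth (mfps_const c :: ('n, 'k) mfps) 0 = c"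
    for F G :: "('n, 'k) mfps" and c
    by (simp_all add: zero_mfps_def one_mfps_def plus_mfps_def uminus_mfps_def mfps_const_def)
  have ideal: "ideal ?m ?R"
  proof (rule idealI)
    show "subgroup ?m (add_monoid ?R)"
    proof (rule subgroup.intro)
      fix x assume "x \<in> ?m"
      hence "\<ominus>\<^bsub>?R\<^esub> x \<in> ?m"
        unfolding minus by (simp add: mfps_maximal_ideal_def nth)
      thus "inv\<^bsub>add_monoid ?R\<^esub> x \<in> ?m"
        unfolding a_inv_def .
    qed (auto simp: mfps_maximal_ideal_def nth)
  qed (auto simp: mfps_maximal_ideal_def mfps_mult_nth_0 R.ring_axioms)
  show ?thesis
  proof (rule maximalidealI[OF ideal])
    have "1 \<notin> ?m" by (simp add: mfps_maximal_ideal_def nth)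
    thus "carrier ?R \<noteq> ?m" unfolding R by blast
  next
    fix J assume J: "ideal J ?R" "?m \<subseteq> J" "J \<subseteq> carrier ?R"
    interpret J: ideal J ?R by fact
    have "1 \<in> J" if "F \<in> J" "F \<notin> ?m" for F
    proof -
      define G where "G = mfps_const (inverse (mfps_nth F 0)) * F"
      have "G \<in> J" using J.I_l_closed[OF that(1), of "mfps_const (inverse (mfps_nth F 0))"]
        by (simp add: G_def)
      moreover have "1 + - G \<in> J"
      proof (rule subsetD[OF J(2)])
        show "1 + - G \<in> ?m"
          using that(2) unfolding mfps_maximal_ideal_def mem_Collect_eq G_def nth mfps_mult_nth_0
          by simp
      qed
      ultimately show ?thesis using J.a_closed[of "1 + - G" G] by simp
    qed
    thus "J = ?m \<or> J = carrier ?R"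
      using J.one_imp_carrier J(2) unfolding R by blast
  qed
qed


section \<open>Milnor and Tjurina numbers\<close>

text \<open>
  The dimension of \<open>R/I\<close> over \<open>k\<close>, where \<open>k\<close> is embedded in \<open>R/I\<close> as the classes of the
  constant power series. For \<open>I = R\<close> the value is \<open>0\<close>.
\<close>

definition mfps_quot_dim :: "('n :: finite, 'k :: field) mfps set \<Rightarrow> enat"
  where "mfps_quot_dim I =
    (let Q = mfps_ring Quot I;
         K = range (\<lambda>c. I +>\<^bsub>mfps_ring\<^esub> mfps_const c)
     in if ring.finite_dimension Q K (carrier Q)
        then enat (ring.dim Q K (carrier Q)) else \<infinity>)"

definition jacobian_ideal :: "('n :: finite, 'k :: field) mfps \<Rightarrow> ('n, 'k) mfps set"
  where "jacobian_ideal F = Idl\<^bsub>mfps_ring\<^esub> (range (\<lambda>i. mfps_deriv i F))"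

definition milnor_number :: "('n :: finite, 'k :: field) mfps \<Rightarrow> enat"
  where "milnor_number F = mfps_quot_dim (jacobian_ideal F)"

definition tjurina_number :: "('n :: finite, 'k :: field) mfps \<Rightarrow> enat"
  where "tjurina_number F =
    mfps_quot_dim ((PIdl\<^bsub>mfps_ring\<^esub> F) <+>\<^bsub>mfps_ring\<^esub> jacobian_ideal F)"


section \<open>Polynomials\<close>

definition mfps_of_mpoly :: "('n :: finite, 'k :: comm_ring_1) mpoly \<Rightarrow> ('n, 'k) mfps"
  where "mfps_of_mpoly f = Abs_mfps (Poly_Mapping.lookup f)"

definition mpoly_eval :: "('n :: finite \<Rightarrow> 'k) \<Rightarrow> ('n, 'k :: comm_ring_1) mpoly \<Rightarrow> 'k"
  where "mpoly_eval x f =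
    (\<Sum>a\<in>Poly_Mapping.keys f. Poly_Mapping.lookup f a * (\<Prod>i\<in>UNIV. x i ^ Poly_Mapping.lookup a i))"

text \<open>
  The subtraction of exponents is truncated, but it is only truncated in terms
  whose coefficient is \<open>0\<close>.
\<close>

definition mpoly_deriv :: "'n \<Rightarrow> ('n :: finite, 'k :: comm_ring_1) mpoly \<Rightarrow> ('n, 'k) mpoly"
  where "mpoly_deriv i f =
    (\<Sum>a\<in>Poly_Mapping.keys f. Poly_Mapping.single (a - Poly_Mapping.single i 1)
        (of_nat (Poly_Mapping.lookup a i) * Poly_Mapping.lookup f a))"

lemma mfps_of_mpoly_deriv: "mfps_of_mpoly (mpoly_deriv i f) = mfps_deriv i (mfps_of_mpoly f)"
proof (rule mfps_eqI)
  fix b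
  let ?s = "Poly_Mapping.single i (1 :: nat)"
  have eq: "a - ?s = b \<longleftrightarrow> a = b + ?s" if "Poly_Mapping.lookup a i \<noteq> 0" for a
  proof
    assume "a - ?s = b"
    moreover have "a - ?s + ?s = a"
      using that by (intro poly_mapping_eqI) (auto simp: lookup_add lookup_minus lookup_single when_def)
    ultimately show "a = b + ?s" by simp
  qed simp
  have "mfps_nth (mfps_of_mpoly (mpoly_deriv i f)) b
      = (\<Sum>a\<in>Poly_Mapping.keys f. if a - ?s = b
           then of_nat (Poly_Mapping.lookup a i) * Poly_Mapping.lookup f a else 0)"
    by (simp add: mfps_of_mpoly_def mpoly_deriv_def lookup_sum lookup_single when_def)
  also have "\<dots> = (\<Sum>a\<in>Poly_Mapping.keys f. if a = b + ?s
           then of_nat (Poly_Mapping.lookup a i) * Poly_Mapping.lookup f a else 0)"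
  proof (rule sum.cong)
    fix a
    show "(if a - ?s = b then of_nat (Poly_Mapping.lookup a i) * Poly_Mapping.lookup f a else 0)
        = (if a = b + ?s then of_nat (Poly_Mapping.lookup a i) * Poly_Mapping.lookup f a else 0)"
      by (cases "Poly_Mapping.lookup a i = 0") (simp_all add: eq del: One_nat_def)
  qed simp
  also have "\<dots> = of_nat (Poly_Mapping.lookup b i + 1) * Poly_Mapping.lookup f (b + ?s)"
    by (simp add: lookup_add in_keys_iff)
  finally show "mfps_nth (mfps_of_mpoly (mpoly_deriv i f)) b
      = mfps_nth (mfps_deriv i (mfps_of_mpoly f)) b"
    by (simp add: mfps_deriv_def mfps_of_mpoly_def)
qed

definition isolated_singularity_at_origin :: "('n :: finite, 'k :: field) mpoly \<Rightarrow> bool"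
  where "isolated_singularity_at_origin f \<longleftrightarrow>
    mfps_of_mpoly f \<in> ideal_prod mfps_ring mfps_maximal_ideal mfps_maximal_ideal \<and>
    tjurina_number (mfps_of_mpoly f) < \<infinity>"


section \<open>Local smoothings\<close>

text \<open>
  Over an algebraically closed field, affine space is represented by its closed points,
  with the topology whose closed sets are the zero loci of sets of polynomials.
\<close>

definition zariski_closed :: "('n :: finite \<Rightarrow> 'k :: field) set \<Rightarrow> bool"
  where "zariski_closed Z \<longleftrightarrow> (\<exists>S :: ('n, 'k) mpoly set. Z = {x. \<forall>p\<in>S. mpoly_eval x p = 0})"

definition zariski_open :: "('n :: finite \<Rightarrow> 'k :: field) set \<Rightarrow> bool"
  where "zariski_open U \<longleftrightarrow> zariski_closed (- U)"

definition mpoly_fiber :: "('n :: finite, 'k :: field) mpoly \<Rightarrow> 'k \<Rightarrow> ('n \<Rightarrow> 'k) set"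
  where "mpoly_fiber f s = {x. mpoly_eval x f = s}"

definition singular_on_fiber ::
    "('n :: finite, 'k :: field) mpoly \<Rightarrow> 'k \<Rightarrow> ('n \<Rightarrow> 'k) \<Rightarrow> bool"
  where "singular_on_fiber f s x \<longleftrightarrow>
    x \<in> mpoly_fiber f s \<and> (\<forall>i. mpoly_eval x (mpoly_deriv i f) = 0)"

definition local_smoothing :: "('n :: finite, 'k :: field) mpoly \<Rightarrow> bool"
  where "local_smoothing f \<longleftrightarrow>
    (\<exists>U. zariski_open U \<and> (\<lambda>_. 0) \<in> U \<and>
         (\<forall>s. s \<noteq> 0 \<longrightarrow> (\<forall>x \<in> mpoly_fiber f s \<inter> U. \<not> singular_on_fiber f s x)))"

end

theory Submission
  imports Defs
begin

text \<open>
  Write \<open>J\<close> for the ideal of partial derivatives and \<open>R\<close> for the power series ring. An ideal \<open>I\<close> of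
  \<open>R\<close> has finite colength iff it contains a common power \<open>X\<^sub>i\<^sup>r\<close> of all the variables.

  If \<open>f\<close> is a local smoothing on \<open>U\<close>, choose a polynomial \<open>h\<close> vanishing off \<open>U\<close> but not at the
  origin. Then \<open>h f\<close> vanishes on the zeros of \<open>J\<close>, so some \<open>(h f)\<^sup>n\<close> lies in \<open>J\<close> by the Nullstellensatz.
  As \<open>h\<close> is a unit of \<open>R\<close>, also \<open>f\<^sup>n\<close> lies in \<open>J R\<close>; since \<open>X\<^sub>i\<^sup>r\<close> lies in \<open>(f) + J R\<close> by finiteness of the
  Tjurina number, \<open>X\<^sub>i\<close> to the power \<open>r n\<close> lies in \<open>J R\<close>. Conversely, if \<open>X\<^sub>i\<^sup>r\<close> lies in \<open>J R\<close>, then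
  Nakayama's lemma gives a polynomial \<open>h\<close> with \<open>h(0) = 0\<close> and \<open>(1 - h) X\<^sub>i\<^sup>r\<close> in \<open>J\<close>, and on the set
  where \<open>1 - h\<close> does not vanish the only zero of \<open>J\<close> is the origin, which lies on the fiber over \<open>0\<close>.
\<close>

section \<open>Ideals of a commutative ring\<close>

text \<open>The ring is a module over itself, so its ideals are the sets satisfying
  \<open>ring_ideal.subspace\<close>, and generated ideals are given by
  \<open>ring_ideal.span\<close>.\<close>

global_interpretation ring_ideal: Modules.module "(*) :: 'a \<Rightarrow> 'a \<Rightarrow> 'a :: comm_ring_1"
  by standard (auto simp: algebra_simps)

declare ring_ideal.scale_scale [simp del] \<comment> \<open>as a rewrite rule it loops against \<open>mult.assoc\<close>\<close>

text \<open>By Zorn's lemma there is an ideal maximal among those that contain \<open>I\<close> and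
  no power of \<open>g\<close>; such an ideal is prime.\<close>

lemma exists_prime_ideal_avoiding_powers:
  fixes I :: "'a :: comm_ring_1 set"
  assumes I: "ring_ideal.subspace I" and g: "\<And>n. g ^ n \<notin> I"
  obtains M where "ring_ideal.subspace M" "I \<subseteq> M" "g \<notin> M"
    "\<And>a b. a * b \<in> M \<Longrightarrow> a \<in> M \<or> b \<in> M"
proof -
  define A where "A = {J. ring_ideal.subspace J \<and> I \<subseteq> J \<and> (\<forall>n. g ^ n \<notin> J)}"
  have "\<exists>J\<in>A. \<forall>L\<in>A. J \<subseteq> L \<longrightarrow> L = J"
  proof (rule subset_Zorn_nonempty)
    show "A \<noteq> {}" using assms by (auto simp: A_def)
  next
    fix C assume C: "C \<noteq> {}" "subset.chain A C"
    have CA: "\<And>J. J \<in> C \<Longrightarrow> J \<in> A" and ch: "\<And>J J'. J \<in> C \<Longrightarrow> J' \<in> C \<Longrightarrow> J \<subseteq> J' \<or> J' \<subseteq> J"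
      using C(2) by (auto simp: subset.chain_def)
    have "ring_ideal.subspace (\<Union>C)"
    proof (rule ring_ideal.subspaceI)
      show "0 \<in> \<Union>C" using C(1) CA ring_ideal.subspace_0 unfolding A_def by blast
      show "c * x \<in> \<Union>C" if "x \<in> \<Union>C" for c x
        using that CA ring_ideal.subspace_scale unfolding A_def by blast
      show "x + y \<in> \<Union>C" if xy: "x \<in> \<Union>C" "y \<in> \<Union>C" for x y
      proof -
        obtain J J' where J: "J \<in> C" "J' \<in> C" "x \<in> J" "y \<in> J'" using xy by blast
        then obtain L where "L \<in> C" "x \<in> L" "y \<in> L" using ch[OF J(1,2)] by blast
        then show ?thesis using CA[of L] ring_ideal.subspace_add[of L x y] by (auto simp: A_def)
      qed
    qed
    then show "\<Union>C \<in> A" using C(1) CA by (fastforce simp: A_def)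
  qed
  then obtain M where M: "M \<in> A" and max: "\<And>L. L \<in> A \<Longrightarrow> M \<subseteq> L \<Longrightarrow> L = M" by blast
  have sM: "ring_ideal.subspace M" using M by (simp add: A_def)
  \<comment> \<open>By maximality, the ideal M + (a) contains a power of \<open>g\<close>.\<close>
  have ext: "\<exists>n m r. m \<in> M \<and> g ^ n = m + r * a" if "a \<notin> M" for a
  proof -
    let ?X = "{m + r * a | m r. m \<in> M}"
    have "ring_ideal.subspace ?X"
    proof (rule ring_ideal.subspaceI)
      show "0 \<in> ?X" using ring_ideal.subspace_0[OF sM] by (force intro: exI[of _ 0])
      show "c * x \<in> ?X" if x: "x \<in> ?X" for c x
      proof -
        obtain m r where "m \<in> M" "x = m + r * a" using x by blast
        then have "c * m \<in> M" "c * x = c * m + (c * r) * a"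
          by (auto simp: algebra_simps ring_ideal.subspace_scale[OF sM])
        then show ?thesis by blast
      qed
      show "x + y \<in> ?X" if xy: "x \<in> ?X" "y \<in> ?X" for x y
      proof -
        obtain m r m' r' where "m \<in> M" "x = m + r * a" "m' \<in> M" "y = m' + r' * a" using xy by blast
        then have "m + m' \<in> M" "x + y = (m + m') + (r + r') * a"
          by (auto simp: algebra_simps ring_ideal.subspace_add[OF sM])
        then show ?thesis by blast
      qed
    qed
    moreover have MX: "M \<subseteq> ?X"
    proof
      fix m assume "m \<in> M"
      then show "m \<in> ?X" by (intro CollectI exI[of _ m] exI[of _ 0]) simp
    qed
    moreover have "a \<in> ?X" using ring_ideal.subspace_0[OF sM] by (force intro: exI[of _ 0] exI[of _ 1])
    ultimately have "?X \<notin> A" using max[of ?X] that by blast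
    then show ?thesis using \<open>ring_ideal.subspace ?X\<close> MX M by (auto simp: A_def)
  qed
  have "a \<in> M \<or> b \<in> M" if ab: "a * b \<in> M" for a b
  proof (rule ccontr)
    assume "\<not> (a \<in> M \<or> b \<in> M)"
    then obtain n m r n' m' r' where *: "m \<in> M" "g ^ n = m + r * a" "m' \<in> M" "g ^ n' = m' + r' * b"
      using ext by metis
    \<comment> \<open>The product of a power of \<open>g\<close> in M + (a) and one in M + (b) lies
      in M + (ab), which is \<open>M\<close>.\<close>
    have "g ^ (n + n') = (m' + r' * b) * m + (r * a) * m' + (r * r') * (a * b)"
      by (simp add: power_add * algebra_simps)
    also have "\<dots> \<in> M"
      using ring_ideal.subspace_scale[OF sM ab] ring_ideal.subspace_scale[OF sM *(1)]
        ring_ideal.subspace_scale[OF sM *(3)] by (intro ring_ideal.subspace_add[OF sM])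
    finally show False using M by (auto simp: A_def)
  qed
  moreover have "g \<notin> M" using M by (auto simp: A_def dest: spec[of _ 1])
  ultimately show ?thesis using that[of M] M by (auto simp: A_def)
qed

text \<open>Nakayama's lemma by elimination instead of determinants. Modulo \<open>J\<close> the
  vector \<open>v\<close> equals a matrix with entries in \<open>m\<close> times itself. Each step
  eliminates one generator at the price of a factor 1 - l with l in \<open>m\<close>, and 1 - h is
  the product of these factors.\<close>

lemma nakayama_elimination:
  fixes m J :: "'a :: comm_ring_1 set"
  assumes "finite B" and m: "ring_ideal.subspace m" and J: "ring_ideal.subspace J"
    and "\<And>b. b \<in> B \<Longrightarrow> \<exists>l. (\<forall>c\<in>B. l c \<in> m) \<and> v b - (\<Sum>c\<in>B. l c * v c) \<in> J"
  shows "\<exists>h\<in>m. \<forall>b\<in>B. (1 - h) * v b \<in> J"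
  using assms(1,4)
proof (induction B rule: finite_induct)
  case empty
  then show ?case using ring_ideal.subspace_0[OF m] by auto
next
  case (insert b B)
  obtain l where l: "l b \<in> m" "\<forall>c\<in>B. l c \<in> m" "v b - (l b * v b + (\<Sum>c\<in>B. l c * v c)) \<in> J"
    using insert.prems[of b] insert.hyps by auto
  have "\<exists>h\<in>m. \<forall>c\<in>B. (1 - h) * v c \<in> J"
  proof (rule insert.IH)
    fix c assume c: "c \<in> B"
    obtain l' where l': "l' b \<in> m" "\<forall>d\<in>B. l' d \<in> m"
      "v c - (l' b * v b + (\<Sum>d\<in>B. l' d * v d)) \<in> J"
      using insert.prems[of c] insert.hyps c by auto
    \<comment> \<open>The relation for \<open>v c\<close> is multiplied by 1 - l b, and (1 - l b) v
      b is replaced by the sum of the l d v d. The extra \<open>l b\<close> at d = c restores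
      \<open>v c\<close> on the left side.\<close>
    define k where "k d = (if d = c then l b else 0) + l d * l' b + (1 - l b) * l' d" for d
    have "\<forall>d\<in>B. k d \<in> m"
      using l l' ring_ideal.subspace_0[OF m] unfolding k_def
      by (auto intro!: ring_ideal.subspace_add[OF m] ring_ideal.subspace_scale[OF m])
    moreover have "v c - (\<Sum>d\<in>B. k d * v d)
        = (1 - l b) * (v c - (l' b * v b + (\<Sum>d\<in>B. l' d * v d)))
          + l' b * (v b - (l b * v b + (\<Sum>d\<in>B. l d * v d)))"
    proof -
      have "(\<Sum>d\<in>B. k d * v d) = (\<Sum>d\<in>B. if d = c then l b * v c else 0)
          + (\<Sum>d\<in>B. l' b * (l d * v d)) + (\<Sum>d\<in>B. (1 - l b) * (l' d * v d))"
        unfolding sum.distrib[symmetric]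
      proof (rule sum.cong)
        fix d
        show "k d * v d = (if d = c then l b * v c else 0) + l' b * (l d * v d)
            + (1 - l b) * (l' d * v d)"
          by (cases "d = c") (simp_all add: k_def algebra_simps)
      qed simp
      also have "\<dots> = l b * v c + l' b * (\<Sum>d\<in>B. l d * v d) + (1 - l b) * (\<Sum>d\<in>B. l' d * v d)"
        using insert.hyps(1) c by (simp add: sum_distrib_left)
      finally show ?thesis by (simp add: algebra_simps)
    qed
    moreover have "\<dots> \<in> J"
      using l l' by (intro ring_ideal.subspace_add[OF J] ring_ideal.subspace_scale[OF J])
    ultimately show "\<exists>l. (\<forall>c\<in>B. l c \<in> m) \<and> v c - (\<Sum>c\<in>B. l c * v c) \<in> J" by metis
  qed
  then obtain h where h: "h \<in> m" "\<And>c. c \<in> B \<Longrightarrow> (1 - h) * v c \<in> J" by blast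
  have eq: "1 - (l b + h * (1 - l b)) = (1 - l b) * (1 - h)" by (simp add: algebra_simps)
  \<comment> \<open>Multiplying the relation for \<open>v b\<close> by 1 - h turns every other
    generator into an element of \<open>J\<close>, which leaves (1 - l b) (1 - h) v b in
    \<open>J\<close>.\<close>
  have "(1 - h) * (v b - (l b * v b + (\<Sum>c\<in>B. l c * v c))) + (\<Sum>c\<in>B. l c * ((1 - h) * v c)) \<in> J"
    using ring_ideal.subspace_scale[OF J l(3)] ring_ideal.subspace_scale[OF J h(2)]
    by (intro ring_ideal.subspace_add[OF J] ring_ideal.subspace_sum[OF J])
  also have "(\<Sum>c\<in>B. l c * ((1 - h) * v c)) = (1 - h) * (\<Sum>c\<in>B. l c * v c)"
    by (simp add: sum_distrib_left mult_ac)
  finally have "(1 - l b) * (1 - h) * v b \<in> J" by (simp add: algebra_simps)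
  moreover have "(1 - l b) * (1 - h) * v c \<in> J" if "c \<in> B" for c
    using ring_ideal.subspace_scale[OF J h(2)[OF that]] by (simp add: mult.assoc)
  moreover have "l b + h * (1 - l b) \<in> m"
    using l h ring_ideal.subspace_scale[OF m, of h "1 - l b"]
    by (intro ring_ideal.subspace_add[OF m]) (auto simp: mult.commute)
  ultimately show ?case
    by (intro bexI[of _ "l b + h * (1 - l b)"]) (auto simp: eq)
qed

section \<open>Elimination of one variable\<close>

text \<open>If the field were finite, one plus the product of all X - c would be a nonconstant
  polynomial without roots.\<close>

lemma infinite_UNIV_alg_closed: "infinite (UNIV :: 'k :: alg_closed_field set)"
proof
  assume fin: "finite (UNIV :: 'k set)"
  define p :: "'k poly" where "p = 1 + (\<Prod>c\<in>UNIV. [:- c, 1:])"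
  have d: "degree (\<Prod>c\<in>(UNIV :: 'k set). [:- c, 1:]) = card (UNIV :: 'k set)"
    by (subst degree_prod_sum_eq) auto
  then have "degree p > 0"
    using fin unfolding p_def by (subst degree_add_eq_right) (auto simp: card_gt_0_iff)
  then obtain z where "poly p z = 0" using alg_closed_imp_poly_has_root by blast
  moreover have "poly p z = 1" using fin by (auto simp: p_def poly_prod prod_zero_iff)
  ultimately show False by simp
qed

text \<open>Subrings are sets inside a fixed ring. For \<open>t\<close> in that ring, A[t] is the
  set of values at \<open>t\<close> of these polynomials, and adjoining elements does not change the
  type.\<close>

definition polys_over :: "'a :: comm_ring_1 set \<Rightarrow> 'a poly set"
  where "polys_over A = {Q. \<forall>i. coeff Q i \<in> A}"

section \<open>Subrings and pseudo-division over them\<close>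

definition unital_subring :: "'a :: comm_ring_1 set \<Rightarrow> bool"
  where "unital_subring A \<longleftrightarrow> 1 \<in> A \<and> (\<forall>a\<in>A. \<forall>b\<in>A. a - b \<in> A \<and> a * b \<in> A)"

lemma
  assumes "unital_subring A"
  shows unital_subring_0: "0 \<in> A" and unital_subring_1: "1 \<in> A"
    and unital_subring_diff: "\<And>a b. a \<in> A \<Longrightarrow> b \<in> A \<Longrightarrow> a - b \<in> A"
    and unital_subring_mult: "\<And>a b. a \<in> A \<Longrightarrow> b \<in> A \<Longrightarrow> a * b \<in> A"
    and unital_subring_add: "\<And>a b. a \<in> A \<Longrightarrow> b \<in> A \<Longrightarrow> a + b \<in> A"
proof -
  show 0: "0 \<in> A" and "1 \<in> A" using assms by (auto simp: unital_subring_def dest!: bspec[of _ _ 1])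
  show diff: "a - b \<in> A" and "a * b \<in> A" if "a \<in> A" "b \<in> A" for a b
    using assms that by (auto simp: unital_subring_def)
  show "a + b \<in> A" if "a \<in> A" "b \<in> A" for a b
    using diff[OF that(1) diff[OF 0 that(2)]] by simp
qed

lemma unital_subring_sum:
  "unital_subring A \<Longrightarrow> (\<And>x. x \<in> S \<Longrightarrow> f x \<in> A) \<Longrightarrow> sum f S \<in> A"
  by (induction S rule: infinite_finite_induct) (auto simp: unital_subring_0 unital_subring_add)

lemma unital_subring_power: "unital_subring A \<Longrightarrow> a \<in> A \<Longrightarrow> a ^ n \<in> A"
  by (induction n) (auto simp: unital_subring_1 unital_subring_mult)

lemma unital_subring_polys_over:
  assumes "unital_subring A" shows "unital_subring (polys_over A)"
  unfolding unital_subring_def[of "polys_over A"] unfolding polys_over_def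
  using assms by (auto simp: coeff_mult unital_subring_0 unital_subring_1 unital_subring_diff
      unital_subring_mult intro!: unital_subring_sum)

lemma monom_in_polys_over: "unital_subring A \<Longrightarrow> a \<in> A \<Longrightarrow> monom a n \<in> polys_over A"
  by (auto simp: polys_over_def unital_subring_0)

lemma smult_in_polys_over: "unital_subring A \<Longrightarrow> a \<in> A \<Longrightarrow> Q \<in> polys_over A \<Longrightarrow> smult a Q \<in> polys_over A"
  by (auto simp: polys_over_def unital_subring_mult)

text \<open>The leading coefficient of \<open>p\<close> need not be invertible, so each step of long
  division first multiplies by it; \<open>e\<close> counts the steps. The degree bound on the
  quotient is used later to compare it with a minimal relation.\<close>

lemma pseudo_division:
  assumes A: "unital_subring A" and p: "p \<in> polys_over A" and "Q \<in> polys_over A"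
  shows "\<exists>e. \<exists>U\<in>polys_over A. \<exists>R\<in>polys_over A. smult (lead_coeff p ^ e) Q = U * p + R \<and>
           (R = 0 \<or> degree R < degree p) \<and> degree U \<le> degree Q - degree p"
  using assms(3)
\<comment> \<open>The measure puts the zero polynomial below the nonzero constants, which the degree
  alone would not do when \<open>p\<close> is constant.\<close>
proof (induction "if Q = 0 then 0 else Suc (degree Q)" arbitrary: Q rule: less_induct)
  case less
  let ?d = "degree p" and ?n = "degree Q" and ?a = "lead_coeff p"
  note A' = unital_subring_polys_over[OF A]
  show ?case
  proof (cases "Q = 0 \<or> ?n < ?d")
    case True
    then show ?thesis
      using less.prems
      by (intro exI[of _ 0] bexI[of _ 0] bexI[of _ Q]) (auto simp: unital_subring_0[OF A'])
  next
    case False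
    define N where "N = monom (lead_coeff Q) (?n - ?d)"
    \<comment> \<open>The leading terms of the two summands cancel.\<close>
    define Q' where "Q' = smult ?a Q - N * p"
    have aA: "?a \<in> A" and NA: "N \<in> polys_over A"
      using p less.prems by (auto simp: N_def polys_over_def unital_subring_0[OF A])
    have Q'A: "Q' \<in> polys_over A" unfolding Q'_def
      by (intro unital_subring_diff[OF A'] unital_subring_mult[OF A'] smult_in_polys_over[OF A]
          aA NA p less.prems)
    have "coeff Q' i = 0" if "i \<ge> ?n" for i
      using that False unfolding Q'_def N_def
      by (cases "i = ?n") (auto simp: coeff_monom_mult coeff_eq_0)
    then have deg: "Q' = 0 \<or> degree Q' < ?n"
      using degree_lessI by (metis leading_coeff_0_iff linorder_not_less)
    have "\<exists>e. \<exists>U\<in>polys_over A. \<exists>R\<in>polys_over A. smult (?a ^ e) Q' = U * p + R \<and>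
           (R = 0 \<or> degree R < ?d) \<and> degree U \<le> degree Q' - ?d"
      using False deg Q'A by (intro less.hyps) auto
    then obtain e U R where *: "U \<in> polys_over A" "R \<in> polys_over A"
      "smult (?a ^ e) Q' = U * p + R" "R = 0 \<or> degree R < ?d" "degree U \<le> degree Q' - ?d" by blast
    have "smult (?a ^ Suc e) Q = (U + smult (?a ^ e) N) * p + R"
      using *(3) by (simp add: Q'_def algebra_simps smult_diff_right)
    moreover have "degree (U + smult (?a ^ e) N) \<le> ?n - ?d"
    proof (rule degree_add_le)
      show "degree U \<le> ?n - ?d" using *(5) deg by auto
      show "degree (smult (?a ^ e) N) \<le> ?n - ?d"
        unfolding N_def by (meson degree_monom_le degree_smult_le le_trans)
    qed
    moreover have "U + smult (?a ^ e) N \<in> polys_over A"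
      by (intro unital_subring_add[OF A'] smult_in_polys_over[OF A] unital_subring_power[OF A] aA NA *)
    ultimately show ?thesis using * by blast
  qed
qed

text \<open>Take a polynomial of least degree among those in \<open>N\<close> with a coefficient
  outside \<open>M\<close>: if its leading coefficient were in \<open>M\<close>, removing the
  leading term would give a smaller one. It plays the role of a minimal polynomial modulo
  \<open>M\<close>.\<close>

lemma exists_poly_with_lead_coeff_outside:
  fixes M :: "'a :: comm_ring_1 set"
  assumes M: "ring_ideal.subspace M" and G: "G \<in> N" "\<exists>i. coeff G i \<notin> M"
    and N: "\<And>Q. Q \<in> N \<Longrightarrow> lead_coeff Q \<in> M \<Longrightarrow> Q - monom (lead_coeff Q) (degree Q) \<in> N"
  obtains p where "p \<in> N" "lead_coeff p \<notin> M"
    "\<And>R i. R \<in> N \<Longrightarrow> R = 0 \<or> degree R < degree p \<Longrightarrow> coeff R i \<in> M"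
proof -
  define S where "S = {Q \<in> N. \<exists>i. coeff Q i \<notin> M}"
  define p where "p = arg_min degree (\<lambda>Q. Q \<in> S)"
  have p: "p \<in> S" "\<And>Q. Q \<in> S \<Longrightarrow> degree p \<le> degree Q"
    using arg_min_nat_lemma[of "\<lambda>Q. Q \<in> S" G degree] G by (auto simp: p_def S_def)
  have "lead_coeff p \<notin> M"
  proof
    assume lc: "lead_coeff p \<in> M"
    let ?q = "p - monom (lead_coeff p) (degree p)"
    obtain i where i: "coeff p i \<notin> M" using p(1) by (auto simp: S_def)
    have "i \<noteq> degree p" using i lc by auto
    then have ci: "coeff ?q i \<notin> M" using i by simp
    moreover have "?q \<in> N" using N[OF _ lc] p(1) by (simp add: S_def)
    ultimately have "?q \<in> S" unfolding S_def by blast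
    moreover have "?q \<noteq> 0" using ci ring_ideal.subspace_0[OF M] by (metis coeff_0)
    then have "degree ?q < degree p"
    proof -
      have "coeff ?q k = 0" if "k \<ge> degree p" for k
        using that by (cases "k = degree p") (simp_all add: coeff_eq_0)
      then show ?thesis using \<open>?q \<noteq> 0\<close> by (intro degree_lessI) blast+
    qed
    ultimately show False using p(2)[of ?q] by simp
  qed
  moreover have "coeff R i \<in> M" if "R \<in> N" "R = 0 \<or> degree R < degree p" for R i
    using that p(2)[of R] ring_ideal.subspace_0[OF M] by (force simp: S_def)
  moreover have "p \<in> N" using p(1) by (simp add: S_def)
  ultimately show ?thesis using that by blast
qed

section \<open>Homomorphisms into a field and their extension\<close>

locale ring_to_field =
  fixes ev :: "'a :: comm_ring_1 \<Rightarrow> 'k :: field"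
  assumes ev_add: "ev (a + b) = ev a + ev b" and ev_mult: "ev (a * b) = ev a * ev b"
    and ev_1: "ev 1 = 1"
begin

lemma ev_0 [simp]: "ev 0 = 0"
  using ev_add[of 0 0] by (metis add_cancel_right_right)

lemma ev_power: "ev (a ^ n) = ev a ^ n"
  by (induction n) (simp_all add: ev_1 ev_mult)

lemma map_poly_add: "map_poly ev (P + Q) = map_poly ev P + map_poly ev Q"
  by (rule poly_eqI) (simp add: coeff_map_poly ev_add)

lemma map_poly_smult': "map_poly ev (smult c Q) = smult (ev c) (map_poly ev Q)"
  by (rule poly_eqI) (simp add: coeff_map_poly ev_mult)

lemma map_poly_mult: "map_poly ev (P * Q) = map_poly ev P * map_poly ev Q"
  by (induction P) (simp_all add: map_poly_add map_poly_smult' map_poly_pCons)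

end

lemma poly_in_ideal:
  assumes M: "ring_ideal.subspace M" and "\<And>i. coeff Q i \<in> M"
  shows "poly Q t \<in> M"
  unfolding poly_altdef using assms(2)
  by (intro ring_ideal.subspace_sum[OF M]) (metis M mult.commute ring_ideal.subspace_scale)

text \<open>
  This replaces the extension theorem for homomorphisms into an algebraically closed field:
  writing \<open>B = A[t]\<close>, a homomorphism on \<open>A / (M \<inter> A)\<close> that does not kill \<open>h\<close> extends
  to a homomorphism on \<open>B / (M \<inter> B)\<close> that does not kill \<open>g = poly G t\<close>. If \<open>t\<close> is
  algebraic modulo \<open>M\<close>, its image is a root of a polynomial \<open>p\<close> of minimal degree, and
  pseudo-division by \<open>p\<close> shows that every relation of \<open>t\<close> is then satisfied.
\<close>

lemma extend_evaluation:
  fixes M :: "'a :: comm_ring_1 set"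
  assumes A: "unital_subring A" and M: "ring_ideal.subspace M"
    and prime: "\<And>a b. a * b \<in> M \<Longrightarrow> a \<in> M \<or> b \<in> M"
    and G: "G \<in> polys_over A" and g: "poly G t \<notin> M"
  obtains h where "h \<in> A" "h \<notin> M"
    "\<And>ev :: 'a \<Rightarrow> 'k :: alg_closed_field. ring_to_field ev \<Longrightarrow> (\<forall>m\<in>M \<inter> A. ev m = 0) \<Longrightarrow> ev h \<noteq> 0 \<Longrightarrow>
       \<exists>c. (\<forall>Q\<in>polys_over A. poly Q t \<in> M \<longrightarrow> poly (map_poly ev Q) c = 0) \<and>
           poly (map_poly ev G) c \<noteq> 0"
proof -
  \<comment> \<open>These are the relations of \<open>t\<close> over \<open>A\<close> modulo
    \<open>M\<close>.\<close>
  define N where "N = {Q \<in> polys_over A. poly Q t \<in> M}"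
  note A' = unital_subring_polys_over[OF A]
  have G_out: "\<exists>i. coeff G i \<notin> M" using poly_in_ideal[OF M] g by blast
  have Ncoeffs: "Q \<in> polys_over A" "poly Q t \<in> M" if "Q \<in> N" for Q
    using that by (auto simp: N_def)
  have eval_zero: "poly (map_poly ev Q) c = 0"
    if "\<And>i. coeff Q i \<in> M" "Q \<in> polys_over A" "ring_to_field ev" "\<forall>m\<in>M \<inter> A. ev m = 0"
    for Q c and ev :: "'a \<Rightarrow> 'k"
  proof -
    have "map_poly ev Q = 0"
      using that by (intro poly_eqI) (auto simp: coeff_map_poly ring_to_field.ev_0 polys_over_def)
    then show ?thesis by simp
  qed
  have power_out: "a ^ n \<notin> M" if "a \<notin> M" for a n
  proof (induction n)
    case 0
    then show ?case using ring_ideal.subspace_scale[OF M, of 1 "poly G t"] g by auto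
  qed (use prime that in auto)
  show ?thesis
  proof (cases "\<forall>Q\<in>N. \<forall>i. coeff Q i \<in> M")
    \<comment> \<open>Here \<open>t\<close> is transcendental modulo \<open>M\<close>: every
      relation maps to the zero polynomial, so any non-root of the image of \<open>G\<close> will
      do. One exists if a coefficient of \<open>G\<close> survives, since the field is infinite;
      that coefficient is taken as \<open>h\<close>.\<close>
    case True
    obtain i where i: "coeff G i \<notin> M" using G_out by blast
    have "\<exists>c. (\<forall>Q\<in>polys_over A. poly Q t \<in> M \<longrightarrow> poly (map_poly ev Q) c = 0) \<and>
           poly (map_poly ev G) c \<noteq> 0"
      if ev: "ring_to_field ev" "\<forall>m\<in>M \<inter> A. ev m = 0" "ev (coeff G i) \<noteq> 0" for ev :: "'a \<Rightarrow> 'k"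
    proof -
      have "coeff (map_poly ev G) i \<noteq> 0"
        using ev by (simp add: coeff_map_poly ring_to_field.ev_0)
      then have "map_poly ev G \<noteq> 0" by auto
      then obtain c where "poly (map_poly ev G) c \<noteq> 0"
        using poly_roots_finite infinite_UNIV_alg_closed ex_new_if_finite by fastforce
      then show ?thesis using eval_zero True ev by (intro exI[of _ c]) (auto simp: N_def)
    qed
    then show ?thesis using that[of "coeff G i"] i G by (auto simp: polys_over_def)
  next
    case False
    then obtain P where P: "P \<in> N" "\<exists>i. coeff P i \<notin> M" by blast
    have drop_lead: "Q - monom (lead_coeff Q) (degree Q) \<in> N" if "Q \<in> N" "lead_coeff Q \<in> M" for Q
    proof -
      have "monom (lead_coeff Q) (degree Q) \<in> polys_over A"
        using Ncoeffs[OF that(1)] by (auto simp: polys_over_def unital_subring_0[OF A])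
      moreover have "poly (monom (lead_coeff Q) (degree Q)) t \<in> M"
        using that(2) ring_ideal.subspace_0[OF M] by (intro poly_in_ideal[OF M]) auto
      ultimately show ?thesis
        using Ncoeffs[OF that(1)]
        by (auto simp: N_def unital_subring_diff[OF A'] ring_ideal.subspace_diff[OF M])
    qed
    obtain p where p: "p \<in> N" "lead_coeff p \<notin> M"
      and p_min: "\<And>R i. R \<in> N \<Longrightarrow> R = 0 \<or> degree R < degree p \<Longrightarrow> coeff R i \<in> M"
      using exists_poly_with_lead_coeff_outside[OF M P drop_lead] by blast
    have p_pos: "degree p > 0"
    proof (rule ccontr)
      assume "\<not> degree p > 0"
      then obtain a where "p = [:a:]" using degree_eq_zeroE by blast
      then show False using p Ncoeffs[OF p(1)] by simp
    qed
    \<comment> \<open>The polynomials whose value at \<open>t\<close> lies in g A[t] + M. A constant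
      \<open>b\<close> among them outside \<open>M\<close> is a multiple of \<open>g\<close> modulo
      \<open>M\<close>, and this keeps the image of \<open>G\<close> from vanishing at the chosen
      root.\<close>
    define N2 where "N2 = {Q \<in> polys_over A. \<exists>U\<in>polys_over A. poly (Q - U * G) t \<in> M}"
    have N2_I: "Q - U * q \<in> N2" if Qq: "Q \<in> N2" "q \<in> N2" and U: "U \<in> polys_over A" for Q U q
    proof -
      obtain V where V: "V \<in> polys_over A" "poly (Q - V * G) t \<in> M"
        using Qq(1) unfolding N2_def mem_Collect_eq by (elim conjE bexE)
      obtain W where W: "W \<in> polys_over A" "poly (q - W * G) t \<in> M"
        using Qq(2) unfolding N2_def mem_Collect_eq by (elim conjE bexE)
      have "poly (Q - U * q - (V - U * W) * G) t
          = poly (Q - V * G) t - poly U t * poly (q - W * G) t"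
        unfolding poly_diff poly_mult by (simp only: algebra_simps)
      also have "\<dots> \<in> M" by (intro ring_ideal.subspace_diff[OF M] ring_ideal.subspace_scale[OF M] V W)
      finally have "poly (Q - U * q - (V - U * W) * G) t \<in> M" .
      moreover have "Q - U * q \<in> polys_over A" "V - U * W \<in> polys_over A"
        using Qq U V W by (auto simp: N2_def unital_subring_diff[OF A'] unital_subring_mult[OF A'])
      ultimately show ?thesis unfolding N2_def by blast
    qed
    have N_N2: "Q \<in> N2" if "Q \<in> N" for Q
      using Ncoeffs[OF that] unital_subring_0[OF A'] by (auto simp: N2_def intro: bexI[of _ 0])
    have G_N2: "G \<in> N2"
      using G unital_subring_1[OF A'] ring_ideal.subspace_0[OF M]
      by (auto simp: N2_def intro: bexI[of _ 1])
    have smult_N2: "smult a Q \<in> N2" if "Q \<in> N2" "a \<in> A" for a Q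
    proof -
      \<comment> \<open>The closure property \<open>N2_I\<close> offers differences only, so a Q is
        written as Q - (1 - a) Q.\<close>
      have "Q - (1 - [:a:]) * Q \<in> N2"
        using that A unital_subring_1[OF A'] unital_subring_0[OF A]
        by (intro N2_I unital_subring_diff[OF A']) (auto simp: polys_over_def coeff_pCons split: nat.split)
      then show ?thesis by (simp add: algebra_simps)
    qed
    have drop_lead2: "Q - monom (lead_coeff Q) (degree Q) \<in> N2"
      if "Q \<in> N2" "lead_coeff Q \<in> M" for Q
    proof -
      have "monom (lead_coeff Q) (degree Q) \<in> N"
        using that ring_ideal.subspace_0[OF M]
        by (auto simp: N_def N2_def polys_over_def unital_subring_0[OF A] intro!: poly_in_ideal[OF M])
      then show ?thesis using N2_I[OF that(1) N_N2 unital_subring_1[OF A']] by simp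
    qed
    obtain q where q: "q \<in> N2" "lead_coeff q \<notin> M"
      and q_min: "\<And>R i. R \<in> N2 \<Longrightarrow> R = 0 \<or> degree R < degree q \<Longrightarrow> coeff R i \<in> M"
      using exists_poly_with_lead_coeff_outside[OF M G_N2 G_out drop_lead2] by blast
    have pA: "p \<in> polys_over A" and qA: "q \<in> polys_over A" using p q by (auto simp: N_def N2_def)
    have lcA: "lead_coeff p \<in> A" "lead_coeff q \<in> A" using pA qA by (auto simp: polys_over_def)
    have q_div: "\<exists>e. \<exists>U\<in>polys_over A. (\<forall>i. coeff (smult (lead_coeff q ^ e) Q - U * q) i \<in> M)
        \<and> degree U \<le> degree Q - degree q" if Q: "Q \<in> N2" for Q
    proof -
      obtain e U R where *: "U \<in> polys_over A" "R \<in> polys_over A"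
        "smult (lead_coeff q ^ e) Q = U * q + R" "R = 0 \<or> degree R < degree q"
        "degree U \<le> degree Q - degree q"
        using pseudo_division[OF A qA, of Q] Q by (auto simp: N2_def)
      have R: "R = smult (lead_coeff q ^ e) Q - U * q" using *(3) by simp
      then have "R \<in> N2"
        using N2_I[OF smult_N2[OF Q] q(1) *(1)] unital_subring_power[OF A lcA(2)] by simp
      then have "coeff (smult (lead_coeff q ^ e) Q - U * q) i \<in> M" for i
        using q_min[of R i] *(4) R by simp
      then show ?thesis using *(1,5) by blast
    qed
    \<comment> \<open>A \<open>q\<close> of positive degree would divide \<open>p\<close> modulo
      \<open>M\<close>, up to a power of its leading coefficient; then q(t) or the value of the
      quotient at \<open>t\<close> would lie in \<open>M\<close>.\<close>
    have "degree q = 0"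
    proof (rule ccontr)
      assume q_pos: "degree q \<noteq> 0"
      obtain e U where U: "U \<in> polys_over A" "degree U \<le> degree p - degree q"
        "\<And>i. coeff (smult (lead_coeff q ^ e) p - U * q) i \<in> M"
        using q_div[OF N_N2[OF p(1)]] by blast
      obtain e' U' where U': "\<And>i. coeff (smult (lead_coeff q ^ e') G - U' * q) i \<in> M"
        using q_div[OF G_N2] by blast
      have "lead_coeff q ^ e * poly p t - poly U t * poly q t \<in> M"
        using poly_in_ideal[OF M U(3), of t] by simp
      then have "poly U t * poly q t \<in> M"
        using ring_ideal.subspace_diff[OF M, OF ring_ideal.subspace_scale[OF M Ncoeffs(2)[OF p(1)],
            of "lead_coeff q ^ e"]] by fastforce
      then consider "poly q t \<in> M" | "poly U t \<in> M" using prime by blast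
      then show False
      proof cases
        \<comment> \<open>Dividing \<open>G\<close> by \<open>q\<close> then puts \<open>g\<close>
          into \<open>M\<close>.\<close>
        case 1
        have "lead_coeff q ^ e' * poly G t - poly U' t * poly q t \<in> M"
          using poly_in_ideal[OF M U', of t] by simp
        from ring_ideal.subspace_add[OF M this ring_ideal.subspace_scale[OF M 1, of "poly U' t"]]
        have "lead_coeff q ^ e' * poly G t \<in> M" by simp
        then show False using prime power_out[OF q(2)] g by blast
      next
        \<comment> \<open>The quotient is a relation of smaller degree than \<open>p\<close>, so its
          coefficients lie in \<open>M\<close>; comparing leading coefficients puts that of
          \<open>p\<close> into \<open>M\<close>.\<close>
        case 2
        have "coeff U i \<in> M" for i
          using U 2 p_pos q_pos by (intro p_min) (auto simp: N_def)
        then have "coeff (U * q) i \<in> M" for i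
          unfolding coeff_mult
          by (intro ring_ideal.subspace_sum[OF M]) (metis M mult.commute ring_ideal.subspace_scale)
        from ring_ideal.subspace_add[OF M this U(3)]
        have "lead_coeff q ^ e * lead_coeff p \<in> M"
          by (metis add_diff_cancel_left' coeff_add coeff_smult diff_add_cancel add.commute)
        then show False using prime power_out[OF q(2)] p(2) by blast
      qed
    qed
    then obtain b where b: "q = [:b:]" using degree_eq_zeroE by blast
    then have bA: "b \<in> A" "b \<notin> M" using lcA q by auto
    obtain V where V: "V \<in> polys_over A" "poly (q - V * G) t \<in> M" using q by (auto simp: N2_def)
    \<comment> \<open>The element \<open>h\<close> is \<open>lead_coeff p * b\<close>: if the first
      factor survives, the image of \<open>p\<close> keeps its positive degree and has a root; the
      second makes \<open>G\<close> nonzero there.\<close>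
    have "\<exists>c. (\<forall>Q\<in>polys_over A. poly Q t \<in> M \<longrightarrow> poly (map_poly ev Q) c = 0) \<and>
           poly (map_poly ev G) c \<noteq> 0"
      if ev: "ring_to_field ev" "\<forall>m\<in>M \<inter> A. ev m = 0" "ev (lead_coeff p * b) \<noteq> 0"
      for ev :: "'a \<Rightarrow> 'k"
    proof -
      interpret ring_to_field ev by fact
      have ab: "ev (lead_coeff p) \<noteq> 0" "ev b \<noteq> 0" using ev(3) by (auto simp: ev_mult)
      have "degree (map_poly ev p) = degree p"
        by (rule map_poly_degree_eq) (use ab in auto)
      then obtain c where c: "poly (map_poly ev p) c = 0"
        using p_pos alg_closed_imp_poly_has_root by metis
      have vanish: "poly (map_poly ev Q) c = 0" if Q: "Q \<in> polys_over A" "poly Q t \<in> M" for Q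
      proof -
        obtain e U R where *: "U \<in> polys_over A" "R \<in> polys_over A"
          "smult (lead_coeff p ^ e) Q = U * p + R" "R = 0 \<or> degree R < degree p"
          using pseudo_division[OF A pA Q(1)] by blast
        have "R = smult (lead_coeff p ^ e) Q - U * p" using *(3) by simp
        then have "poly R t = lead_coeff p ^ e * poly Q t - poly U t * poly p t" by simp
        then have "R \<in> N"
          using *(2) Q(2) Ncoeffs[OF p(1)] ring_ideal.subspace_diff[OF M] ring_ideal.subspace_scale[OF M]
          by (simp add: N_def)
        then have "poly (map_poly ev R) c = 0"
          using p_min *(4) by (intro eval_zero[OF _ *(2) ev(1,2)]) auto
        then have "ev (lead_coeff p) ^ e * poly (map_poly ev Q) c = 0"
          using arg_cong[OF *(3), of "\<lambda>P. poly (map_poly ev P) c"] c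
          by (simp add: map_poly_smult' map_poly_add map_poly_mult ev_power)
        then show ?thesis using ab by simp
      qed
      \<comment> \<open>In the image this says that V(c) G(c) equals \<open>ev b\<close>, which is
        nonzero.\<close>
      have "poly (map_poly ev (q - V * G)) c = 0"
        using V qA G by (intro vanish unital_subring_diff[OF A'] unital_subring_mult[OF A'])
      then have "poly (map_poly ev (V * G)) c = poly (map_poly ev q) c"
        by (metis add.left_neutral diff_add_cancel map_poly_add poly_add)
      then have "poly (map_poly ev G) c \<noteq> 0"
        using ab by (auto simp: b map_poly_mult map_poly_pCons)
      then show ?thesis using vanish by blast
    qed
    then show ?thesis
      using that[of "lead_coeff p * b"] prime p(2) bA lcA(1) unital_subring_mult[OF A] by blast
  qed
qed

section \<open>Hilbert's Nullstellensatz\<close>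

lemma poly_mapping_eq_sum_single:
  assumes "finite S" "Poly_Mapping.keys f \<subseteq> S"
  shows "f = (\<Sum>a\<in>S. Poly_Mapping.single a (Poly_Mapping.lookup f a))"
proof (rule poly_mapping_eqI)
  fix b
  have "(\<Sum>a\<in>S. Poly_Mapping.lookup (Poly_Mapping.single a (Poly_Mapping.lookup f a)) b)
      = (\<Sum>a\<in>S. if a = b then Poly_Mapping.lookup f b else 0)"
    by (rule sum.cong) (auto simp: lookup_single when_def)
  also have "\<dots> = Poly_Mapping.lookup f b"
    using assms by (auto simp: not_in_keys_iff_lookup_eq_zero)
  finally show "Poly_Mapping.lookup f b
      = Poly_Mapping.lookup (\<Sum>a\<in>S. Poly_Mapping.single a (Poly_Mapping.lookup f a)) b"
    by (simp add: lookup_sum)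
qed

abbreviation mpoly_const :: "'k \<Rightarrow> ('n, 'k :: comm_ring_1) mpoly"
  where "mpoly_const c \<equiv> Poly_Mapping.single 0 c"

definition mpoly_var :: "'n \<Rightarrow> ('n, 'k :: comm_ring_1) mpoly"
  where "mpoly_var i = Poly_Mapping.single (Poly_Mapping.single i 1) 1"

lemma mpoly_var_power: "mpoly_var i ^ n = Poly_Mapping.single (Poly_Mapping.single i n) 1"
  by (induction n) (simp_all add: mpoly_var_def mult_single flip: single_add)

lemma single_eq_const_times_prod_vars:
  "Poly_Mapping.single a c = mpoly_const c * (\<Prod>i\<in>UNIV. mpoly_var i ^ Poly_Mapping.lookup a i)"
  for a :: "'n :: finite expo" and c :: "'k :: comm_ring_1"
proof -
  have "(\<Prod>i\<in>S. mpoly_var i ^ Poly_Mapping.lookup a i)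
      = Poly_Mapping.single (\<Sum>i\<in>S. Poly_Mapping.single i (Poly_Mapping.lookup a i)) (1 :: 'k)"
    if "finite S" for S
    using that by induction (simp_all add: mpoly_var_power mult_single)
  from this[of UNIV] show ?thesis
    by (simp add: mult_single flip: poly_mapping_eq_sum_single)
qed

lemma mpoly_eval_superset:
  assumes "finite S" "Poly_Mapping.keys f \<subseteq> S"
  shows "mpoly_eval x f = (\<Sum>a\<in>S. Poly_Mapping.lookup f a * (\<Prod>i\<in>UNIV. x i ^ Poly_Mapping.lookup a i))"
  unfolding mpoly_eval_def using assms
  by (intro sum.mono_neutral_left) (auto simp: not_in_keys_iff_lookup_eq_zero)

lemma mpoly_eval_add: "mpoly_eval x (f + g) = mpoly_eval x f + mpoly_eval x g"
  using mpoly_eval_superset[of "Poly_Mapping.keys f \<union> Poly_Mapping.keys g" _ x] keys_add[of f g]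
  by (simp add: lookup_add algebra_simps sum.distrib)

lemma mpoly_eval_zero [simp]: "mpoly_eval x 0 = 0"
  by (simp add: mpoly_eval_def)

lemma mpoly_eval_sum: "mpoly_eval x (sum f S) = (\<Sum>a\<in>S. mpoly_eval x (f a))"
  by (induction S rule: infinite_finite_induct) (simp_all add: mpoly_eval_add)

lemma mpoly_eval_single:
  "mpoly_eval x (Poly_Mapping.single a c) = c * (\<Prod>i\<in>UNIV. x i ^ Poly_Mapping.lookup a i)"
  by (simp add: mpoly_eval_def)

lemma mpoly_eval_const [simp]: "mpoly_eval x (mpoly_const c) = c"
  by (simp add: mpoly_eval_single)

lemma mpoly_eval_var [simp]: "mpoly_eval x (mpoly_var i) = x i"
proof -
  have "(\<Prod>j\<in>UNIV. x j ^ Poly_Mapping.lookup (Poly_Mapping.single i 1) j) = (\<Prod>j\<in>UNIV. if j = i then x i else 1)"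
    by (rule prod.cong) (auto simp: lookup_single when_def)
  then show ?thesis by (simp add: mpoly_var_def mpoly_eval_single)
qed

lemma mpoly_eval_mult: "mpoly_eval x (f * g) = mpoly_eval x f * mpoly_eval x g"
proof -
  have "f * g = (\<Sum>a\<in>Poly_Mapping.keys f. \<Sum>b\<in>Poly_Mapping.keys g.
      Poly_Mapping.single (a + b) (Poly_Mapping.lookup f a * Poly_Mapping.lookup g b))"
    by (subst (1 2) poly_mapping_eq_sum_single[OF finite_keys order_refl])
       (simp add: sum_product mult_single)
  then have "mpoly_eval x (f * g) = (\<Sum>a\<in>Poly_Mapping.keys f. \<Sum>b\<in>Poly_Mapping.keys g.
      (Poly_Mapping.lookup f a * (\<Prod>i\<in>UNIV. x i ^ Poly_Mapping.lookup a i)) *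
      (Poly_Mapping.lookup g b * (\<Prod>i\<in>UNIV. x i ^ Poly_Mapping.lookup b i)))"
    by (simp add: mpoly_eval_sum mpoly_eval_single lookup_add power_add prod.distrib mult_ac)
  then show ?thesis by (simp add: mpoly_eval_def sum_product)
qed

interpretation mpoly_eval: ring_to_field "mpoly_eval (x :: 'n :: finite \<Rightarrow> 'k :: field)" for x
  by unfold_locales (simp_all add: mpoly_eval_add mpoly_eval_mult flip: single_one)

lemma mpoly_eval_diff: "mpoly_eval x (f - g) = mpoly_eval x f - mpoly_eval x g"
  using mpoly_eval_add[of x "f - g" g] by (simp add: eq_diff_eq)

text \<open>The subring generated by the constants and the variables in \<open>S\<close>. It allows
  induction on the set of variables within one type.\<close>

inductive_set polys_in :: "'n set \<Rightarrow> ('n, 'k :: comm_ring_1) mpoly set" for S where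
  const: "mpoly_const c \<in> polys_in S"
| var: "i \<in> S \<Longrightarrow> mpoly_var i \<in> polys_in S"
| diff: "p \<in> polys_in S \<Longrightarrow> q \<in> polys_in S \<Longrightarrow> p - q \<in> polys_in S"
| mult: "p \<in> polys_in S \<Longrightarrow> q \<in> polys_in S \<Longrightarrow> p * q \<in> polys_in S"

lemma unital_subring_polys_in: "unital_subring (polys_in S)"
  unfolding unital_subring_def using polys_in.const[of 1 S] by (auto intro: polys_in.intros)

lemma polys_in_UNIV: "f \<in> polys_in (UNIV :: 'n :: finite set)"
proof -
  note A = unital_subring_polys_in[of "UNIV :: 'n set"]
  have "(\<Prod>i\<in>S. mpoly_var i ^ n i) \<in> polys_in (UNIV :: 'n set)" for S :: "'n set" and n
    by (induction S rule: infinite_finite_induct)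
       (auto intro: unital_subring_1[OF A] unital_subring_mult[OF A] unital_subring_power[OF A] polys_in.var)
  then have "Poly_Mapping.single a c \<in> polys_in (UNIV :: 'n set)" for a c
    by (subst single_eq_const_times_prod_vars) (intro polys_in.mult polys_in.const)
  then show ?thesis
    by (subst poly_mapping_eq_sum_single[OF finite_keys order_refl]) (rule unital_subring_sum[OF A])
qed

lemma polys_in_empty: "p \<in> polys_in {} \<Longrightarrow> \<exists>c. p = mpoly_const c"
  by (induction rule: polys_in.induct) (auto simp: mult_single simp flip: single_diff)

lemma mpoly_eval_cong:
  assumes "p \<in> polys_in S" "\<And>i. i \<in> S \<Longrightarrow> x i = y i"
  shows "mpoly_eval x p = mpoly_eval y p"
  using assms by induction (simp_all add: mpoly_eval_diff mpoly_eval_mult)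

text \<open>This brings the subring into the form A[t] that \<open>extend_evaluation\<close>
  expects.\<close>

lemma polys_in_insert:
  assumes "p \<in> polys_in (insert i S)"
  shows "\<exists>Q\<in>polys_over (polys_in S). p = poly Q (mpoly_var i)"
proof -
  note A = unital_subring_polys_in[of S]
  note A' = unital_subring_polys_over[OF A]
  have lift: "\<exists>Q\<in>polys_over (polys_in S). q = poly Q (mpoly_var i)" if "q \<in> polys_in S" for q
    using monom_in_polys_over[OF A that, of 0] by (force simp: monom_0)
  show ?thesis using assms
  proof induction
    case (const c)
    show ?case by (rule lift[OF polys_in.const])
  next
    case (var j)
    have "monom 1 1 \<in> polys_over (polys_in S)" "mpoly_var i = poly (monom 1 1) (mpoly_var i)"
      by (auto simp: poly_monom intro: monom_in_polys_over[OF A] unital_subring_1[OF A])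
    then show ?case using var lift[OF polys_in.var, of j] by blast
  next
    case (diff p q)
    then show ?case using unital_subring_diff[OF A'] by (metis poly_diff)
  next
    case (mult p q)
    then show ?case using unital_subring_mult[OF A'] by (metis poly_mult)
  qed
qed

lemma (in ring_to_field) ev_poly: "ev (poly Q t) = poly (map_poly ev Q) (ev t)"
  by (induction Q) (simp_all add: ev_add ev_mult map_poly_pCons)

text \<open>Induction over the variables. A zero in the coordinates \<open>S\<close> extends to one
  more coordinate provided that some \<open>h\<close> outside \<open>M\<close> does not vanish
  there, which is why the statement carries an element \<open>g\<close>.\<close>

lemma prime_ideal_zero:
  fixes M :: "('n :: finite, 'k :: alg_closed_field) mpoly set"
  assumes M: "ring_ideal.subspace M" and prime: "\<And>a b. a * b \<in> M \<Longrightarrow> a \<in> M \<or> b \<in> M"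
    and "finite S" "g \<in> polys_in S" "g \<notin> M"
  shows "\<exists>x. (\<forall>p\<in>M \<inter> polys_in S. mpoly_eval x p = 0) \<and> mpoly_eval x g \<noteq> 0"
  using assms(3-5)
proof (induction S arbitrary: g rule: finite_induct)
  case empty
  obtain c where c: "g = mpoly_const c" using empty polys_in_empty by blast
  \<comment> \<open>Polynomials without variables are constants, and a nonzero constant in
    \<open>M\<close> would put \<open>g\<close> into \<open>M\<close>.\<close>
  have "mpoly_eval (\<lambda>_. 0) p = 0" if p: "p \<in> M" "p \<in> polys_in {}" for p
  proof (rule ccontr)
    obtain d where d: "p = mpoly_const d" using p polys_in_empty by blast
    assume "mpoly_eval (\<lambda>_. 0) p \<noteq> 0"
    then have "d \<noteq> 0" by (simp add: d)
    then have "mpoly_const (c / d) * p = g" by (simp add: c d mult_single)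
    then show False using ring_ideal.subspace_scale[OF M p(1)] empty by metis
  qed
  moreover have "mpoly_eval (\<lambda>_. 0) g \<noteq> 0"
    using empty ring_ideal.subspace_0[OF M] by (auto simp: c)
  ultimately show ?case by blast
next
  case (insert i S)
  obtain G where G: "G \<in> polys_over (polys_in S)" "g = poly G (mpoly_var i)"
    using polys_in_insert[OF insert.prems(1)] by blast
  obtain h where h: "h \<in> polys_in S" "h \<notin> M"
    "\<And>ev :: _ \<Rightarrow> 'k. ring_to_field ev \<Longrightarrow> (\<forall>m\<in>M \<inter> polys_in S. ev m = 0) \<Longrightarrow> ev h \<noteq> 0 \<Longrightarrow>
       \<exists>c. (\<forall>Q\<in>polys_over (polys_in S). poly Q (mpoly_var i) \<in> M \<longrightarrow> poly (map_poly ev Q) c = 0) \<and>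
           poly (map_poly ev G) c \<noteq> 0"
    using extend_evaluation[OF unital_subring_polys_in M prime G(1), of "mpoly_var i", where ?'k = 'k]
      insert.prems(2) G(2) by blast
  obtain x where x: "\<forall>p\<in>M \<inter> polys_in S. mpoly_eval x p = 0" "mpoly_eval x h \<noteq> 0"
    using insert.IH[OF h(1,2)] by blast
  obtain c where c: "\<And>Q. Q \<in> polys_over (polys_in S) \<Longrightarrow> poly Q (mpoly_var i) \<in> M \<Longrightarrow>
      poly (map_poly (mpoly_eval x) Q) c = 0" "poly (map_poly (mpoly_eval x) G) c \<noteq> 0"
    using h(3)[OF mpoly_eval.ring_to_field_axioms x] by blast
  define y where "y = x(i := c)"
  \<comment> \<open>The coefficients do not involve the variable \<open>i\<close>, so evaluation at
    \<open>y\<close> evaluates them at \<open>x\<close> and then puts \<open>c\<close> for the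
    variable.\<close>
  have eq: "mpoly_eval y (poly Q (mpoly_var i)) = poly (map_poly (mpoly_eval x) Q) c"
    if "Q \<in> polys_over (polys_in S)" for Q
  proof -
    have "mpoly_eval y q = mpoly_eval x q" if "q \<in> polys_in S" for q
      using insert.hyps(2) by (intro mpoly_eval_cong[OF that]) (auto simp: y_def)
    then have "map_poly (mpoly_eval y) Q = map_poly (mpoly_eval x) Q"
      using that by (intro poly_eqI) (auto simp: coeff_map_poly polys_over_def)
    then show ?thesis by (simp add: mpoly_eval.ev_poly y_def)
  qed
  have "mpoly_eval y p = 0" if "p \<in> M" "p \<in> polys_in (insert i S)" for p
    using polys_in_insert[OF that(2)] that(1) c(1) eq by auto
  moreover have "mpoly_eval y g \<noteq> 0" using G c(2) eq by simp
  ultimately show ?case by blast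
qed

text \<open>If no power of \<open>g\<close> lies in \<open>I\<close>, some prime ideal contains
  \<open>I\<close> but not \<open>g\<close>, and it has a zero at which \<open>g\<close> does not
  vanish.\<close>

theorem nullstellensatz:
  fixes I :: "('n :: finite, 'k :: alg_closed_field) mpoly set"
  assumes I: "ring_ideal.subspace I"
    and "\<And>x. (\<And>p. p \<in> I \<Longrightarrow> mpoly_eval x p = 0) \<Longrightarrow> mpoly_eval x g = 0"
  shows "\<exists>n. g ^ n \<in> I"
proof (rule ccontr)
  assume "\<nexists>n. g ^ n \<in> I"
  then obtain M where M: "ring_ideal.subspace M" "I \<subseteq> M" "g \<notin> M"
    "\<And>a b. a * b \<in> M \<Longrightarrow> a \<in> M \<or> b \<in> M"
    using exists_prime_ideal_avoiding_powers[OF I, of g] by blast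
  obtain x where "\<forall>p\<in>M. mpoly_eval x p = 0" "mpoly_eval x g \<noteq> 0"
    using prime_ideal_zero[OF M(1,4) finite_UNIV polys_in_UNIV M(3)] polys_in_UNIV by blast
  then show False using assms(2)[of x] M(2) by blast
qed

section \<open>Power series\<close>

lemma mfps_nth_simps [simp]:
  "mfps_nth 0 a = 0" "mfps_nth (F + G) a = mfps_nth F a + mfps_nth G a"
  "mfps_nth (F - G) a = mfps_nth F a - mfps_nth G a"
  "mfps_nth (- F) a = - mfps_nth F a"
  by (simp_all add: zero_mfps_def plus_mfps_def minus_mfps_def uminus_mfps_def)

lemma mfps_nth_1: "mfps_nth 1 a = (if a = 0 then 1 else 0)"
  by (simp add: one_mfps_def)

lemma mfps_nth_sum: "mfps_nth (sum F S) a = (\<Sum>x\<in>S. mfps_nth (F x) a)"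
  by (induction S rule: infinite_finite_induct) simp_all

lemma mfps_nth_mult: "mfps_nth (F * G) c = (\<Sum>p | fst p + snd p = c. mfps_nth F (fst p) * mfps_nth G (snd p))"
  by (simp add: times_mfps_def case_prod_unfold)

lemma finite_expo_decomp': "finite {p. fst p + snd p = (c :: 'n :: finite expo)}"
  using finite_expo_decomp[of c] by (simp add: case_prod_unfold)

lemma mfps_nth_of_mpoly [simp]: "mfps_nth (mfps_of_mpoly f) a = Poly_Mapping.lookup f a"
  by (simp add: mfps_of_mpoly_def)

text \<open>As subtraction is truncated, \<open>e + (a - e) = a\<close> says that the monomial with
  exponent \<open>e\<close> divides the one with exponent \<open>a\<close>.\<close>

lemma mfps_nth_single_mult:
  "mfps_nth (mfps_of_mpoly (Poly_Mapping.single e k) * G) a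
     = (if e + (a - e) = a then k * mfps_nth G (a - e) else 0)"
proof -
  have "mfps_nth (mfps_of_mpoly (Poly_Mapping.single e k) * G) a
      = (\<Sum>p | fst p + snd p = a. if p = (e, a - e) then k * mfps_nth G (a - e) else 0)"
    unfolding mfps_nth_mult
    by (rule sum.cong) (auto simp: lookup_single when_def prod_eq_iff)
  then show ?thesis using finite_expo_decomp'[of a] by simp
qed

lemma mfps_of_mpoly_0 [simp]: "mfps_of_mpoly 0 = 0"
  by (rule mfps_eqI) simp

lemma mfps_of_mpoly_1 [simp]: "mfps_of_mpoly 1 = 1"
  by (rule mfps_eqI) (simp add: mfps_nth_1 lookup_one when_def)

lemma mfps_of_mpoly_add: "mfps_of_mpoly (f + g) = mfps_of_mpoly f + mfps_of_mpoly g"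
  by (rule mfps_eqI) (simp add: lookup_add)

lemma mfps_of_mpoly_diff: "mfps_of_mpoly (f - g) = mfps_of_mpoly f - mfps_of_mpoly g"
  by (rule mfps_eqI) (simp add: lookup_minus)

lemma mfps_of_mpoly_sum: "mfps_of_mpoly (sum f S) = (\<Sum>x\<in>S. mfps_of_mpoly (f x))"
  by (induction S rule: infinite_finite_induct) (simp_all add: mfps_of_mpoly_add)

lemma mfps_of_mpoly_single_mult:
  "mfps_of_mpoly (Poly_Mapping.single a c * g) = mfps_of_mpoly (Poly_Mapping.single a c) * mfps_of_mpoly g"
proof -
  have *: "mfps_of_mpoly (Poly_Mapping.single a c * Poly_Mapping.single b d)
      = mfps_of_mpoly (Poly_Mapping.single a c) * mfps_of_mpoly (Poly_Mapping.single b d)" for b d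
  proof (rule mfps_eqI)
    fix e
    have "a + b = e \<longleftrightarrow> a + (e - a) = e \<and> b = e - a" by auto
    then show "mfps_nth (mfps_of_mpoly (Poly_Mapping.single a c * Poly_Mapping.single b d)) e
      = mfps_nth (mfps_of_mpoly (Poly_Mapping.single a c) * mfps_of_mpoly (Poly_Mapping.single b d)) e"
      by (auto simp: mfps_nth_single_mult mult_single lookup_single when_def)
  qed
  have "mfps_of_mpoly (Poly_Mapping.single a c * (\<Sum>b\<in>Poly_Mapping.keys g. Poly_Mapping.single b (Poly_Mapping.lookup g b)))
      = mfps_of_mpoly (Poly_Mapping.single a c) *
        mfps_of_mpoly (\<Sum>b\<in>Poly_Mapping.keys g. Poly_Mapping.single b (Poly_Mapping.lookup g b))"
    by (simp add: sum_distrib_left mfps_of_mpoly_sum *)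
  then show ?thesis by (simp flip: poly_mapping_eq_sum_single)
qed

lemma mfps_of_mpoly_mult: "mfps_of_mpoly (f * g) = mfps_of_mpoly f * mfps_of_mpoly g"
proof -
  have "mfps_of_mpoly ((\<Sum>a\<in>Poly_Mapping.keys f. Poly_Mapping.single a (Poly_Mapping.lookup f a)) * g)
      = mfps_of_mpoly (\<Sum>a\<in>Poly_Mapping.keys f. Poly_Mapping.single a (Poly_Mapping.lookup f a)) * mfps_of_mpoly g"
    by (simp add: sum_distrib_right mfps_of_mpoly_sum mfps_of_mpoly_single_mult)
  then show ?thesis by (simp flip: poly_mapping_eq_sum_single)
qed

lemma mfps_of_mpoly_power: "mfps_of_mpoly (f ^ n) = mfps_of_mpoly f ^ n"
  by (induction n) (simp_all add: mfps_of_mpoly_mult)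

lemma mfps_const_eq: "mfps_const c = mfps_of_mpoly (mpoly_const c)"
  by (rule mfps_eqI) (simp add: mfps_const_def lookup_single when_def)

lemma mfps_const_0 [simp]: "mfps_const 0 = 0"
  by (simp add: mfps_const_eq)

section \<open>Terms divisible by powers of the variables\<close>

definition mfps_var :: "'n \<Rightarrow> ('n :: finite, 'k :: comm_ring_1) mfps"
  where "mfps_var i = mfps_of_mpoly (mpoly_var i)"

lemma mfps_nth_var_power_mult:
  "mfps_nth (mfps_var i ^ r * G) a
     = (if r \<le> Poly_Mapping.lookup a i then mfps_nth G (a - Poly_Mapping.single i r) else 0)"
proof -
  have "Poly_Mapping.single i r + (a - Poly_Mapping.single i r) = a \<longleftrightarrow> r \<le> Poly_Mapping.lookup a i"
    by (auto simp: poly_mapping_eq_iff fun_eq_iff lookup_add lookup_minus lookup_single when_def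
        split: if_splits)
  then show ?thesis
    by (simp add: mfps_var_def mpoly_var_power mfps_nth_single_mult flip: mfps_of_mpoly_power)
qed

lemma mfps_high_order_terms:
  assumes "\<And>a. mfps_nth F a \<noteq> 0 \<Longrightarrow> \<exists>i. r \<le> Poly_Mapping.lookup a i"
  shows "\<exists>G. F = (\<Sum>i\<in>UNIV. mfps_var i ^ r * G i)"
proof -
  \<comment> \<open>A monomial may be divisible by several of the powers; \<open>ch\<close> selects
    one, so that each coefficient is counted once.\<close>
  define ch where "ch a = (SOME i. r \<le> Poly_Mapping.lookup a i)" for a :: "'a expo"
  define G where "G i = Abs_mfps (\<lambda>b. if ch (b + Poly_Mapping.single i r) = i
    then mfps_nth F (b + Poly_Mapping.single i r) else 0)" for i
  have "F = (\<Sum>i\<in>UNIV. mfps_var i ^ r * G i)"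
  proof (rule mfps_eqI)
    fix a
    have "mfps_nth (\<Sum>i\<in>UNIV. mfps_var i ^ r * G i) a
        = (\<Sum>i\<in>UNIV. if i = ch a then (if r \<le> Poly_Mapping.lookup a i then mfps_nth F a else 0) else 0)"
      unfolding mfps_nth_sum
    proof (rule sum.cong)
      fix i
      have "a - Poly_Mapping.single i r + Poly_Mapping.single i r = a" if "r \<le> Poly_Mapping.lookup a i"
        using that by (intro poly_mapping_eqI) (auto simp: lookup_add lookup_minus lookup_single when_def)
      then show "mfps_nth (mfps_var i ^ r * G i) a
          = (if i = ch a then (if r \<le> Poly_Mapping.lookup a i then mfps_nth F a else 0) else 0)"
        by (auto simp: mfps_nth_var_power_mult G_def)
    qed simp
    also have "\<dots> = (if r \<le> Poly_Mapping.lookup a (ch a) then mfps_nth F a else 0)" by simp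
    also have "\<dots> = mfps_nth F a"
      using assms[of a] someI_ex[of "\<lambda>i. r \<le> Poly_Mapping.lookup a i"] by (auto simp: ch_def)
    finally show "mfps_nth F a = mfps_nth (\<Sum>i\<in>UNIV. mfps_var i ^ r * G i) a" by simp
  qed
  then show ?thesis by blast
qed

text \<open>The strict inequality leaves a monomial of positive degree after division by X_i^r.
  Hence the multipliers have no constant term, as Nakayama's lemma requires.\<close>

lemma mpoly_high_order_terms:
  fixes f :: "('n :: finite, 'k :: comm_ring_1) mpoly"
  assumes "\<And>a. a \<in> Poly_Mapping.keys f \<Longrightarrow> \<exists>i. r < Poly_Mapping.lookup a i"
  shows "\<exists>l. (\<forall>i. Poly_Mapping.lookup (l i) 0 = 0) \<and> f = (\<Sum>i\<in>UNIV. l i * mpoly_var i ^ r)"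
    (is "\<exists>l. ?P l f")
proof -
  have "\<exists>l. ?P l (\<Sum>a\<in>S. Poly_Mapping.single a (Poly_Mapping.lookup f a))"
    if "finite S" "S \<subseteq> Poly_Mapping.keys f" for S
    using that
  proof (induction S rule: finite_induct)
    case empty
    show ?case by (intro exI[of _ "\<lambda>_. 0"]) simp
  next
    case (insert a S)
    obtain l where l: "?P l (\<Sum>a\<in>S. Poly_Mapping.single a (Poly_Mapping.lookup f a))"
      using insert by auto
    obtain i where i: "r < Poly_Mapping.lookup a i" using assms insert.prems by blast
    define m where "m = Poly_Mapping.single (a - Poly_Mapping.single i r) (Poly_Mapping.lookup f a)"
    have "a - Poly_Mapping.single i r + Poly_Mapping.single i r = a"
      using i by (intro poly_mapping_eqI) (auto simp: lookup_add lookup_minus lookup_single when_def)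
    then have "Poly_Mapping.single a (Poly_Mapping.lookup f a) = m * mpoly_var i ^ r"
      by (simp add: m_def mpoly_var_power mult_single)
    moreover have "a - Poly_Mapping.single i r \<noteq> 0"
    proof
      assume "a - Poly_Mapping.single i r = 0"
      then have "Poly_Mapping.lookup (a - Poly_Mapping.single i r) i = 0" by simp
      then show False using i by (simp add: lookup_minus)
    qed
    then have "Poly_Mapping.lookup m 0 = 0" by (simp add: m_def lookup_single when_def)
    moreover have "(\<Sum>j\<in>UNIV. (l j + (if j = i then m else 0)) * mpoly_var j ^ r)
        = (\<Sum>j\<in>UNIV. l j * mpoly_var j ^ r) + m * mpoly_var i ^ r"
    proof -
      have "(\<Sum>j\<in>UNIV. (l j + (if j = i then m else 0)) * mpoly_var j ^ r)
          = (\<Sum>j\<in>UNIV. l j * mpoly_var j ^ r + (if j = i then m * mpoly_var j ^ r else 0))"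
        by (rule sum.cong) (auto simp: algebra_simps)
      then show ?thesis by (simp add: sum.distrib)
    qed
    ultimately show ?case
      using l insert.hyps
      by (intro exI[of _ "\<lambda>j. l j + (if j = i then m else 0)"]) (auto simp: lookup_add algebra_simps)
  qed
  from this[of "Poly_Mapping.keys f"] show ?thesis
    by (simp flip: poly_mapping_eq_sum_single)
qed

lemma finite_expo_box: "finite {a :: 'n :: finite expo. \<forall>i. Poly_Mapping.lookup a i < r}"
proof (rule finite_imageD)
  have "Poly_Mapping.lookup ` {a :: 'n expo. \<forall>i. Poly_Mapping.lookup a i < r} \<subseteq> PiE UNIV (\<lambda>_. {..<r})"
    by auto
  then show "finite (Poly_Mapping.lookup ` {a :: 'n expo. \<forall>i. Poly_Mapping.lookup a i < r})"
    by (rule finite_subset) (simp add: finite_PiE)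
qed (simp add: inj_on_def poly_mapping_eqI)

section \<open>Inverses of power series\<close>

lemma total_degree_less:
  fixes a b :: "'n :: finite expo"
  assumes "a \<noteq> 0"
  shows "(\<Sum>i\<in>UNIV. Poly_Mapping.lookup b i) < (\<Sum>i\<in>UNIV. Poly_Mapping.lookup (a + b) i)"
proof -
  obtain i where "Poly_Mapping.lookup a i \<noteq> 0"
    using assms by (auto simp: poly_mapping_eq_iff fun_eq_iff)
  then show ?thesis by (intro sum_strict_mono_ex1) (auto simp: lookup_add)
qed

text \<open>The equation F G = 1 is solved for the coefficients of G by recursion on the total
  degree: the coefficient of F G at \<open>c\<close> contains that of G at \<open>c\<close> only in
  the term with factor \<open>mfps_nth F 0\<close>.\<close>

function mfps_inverse_coeff :: "('n :: finite, 'k :: field) mfps \<Rightarrow> 'n expo \<Rightarrow> 'k" where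
  "mfps_inverse_coeff F c = (if c = 0 then 1 else
     - (\<Sum>p | fst p + snd p = c \<and> fst p \<noteq> 0. mfps_nth F (fst p) * mfps_inverse_coeff F (snd p)))
     / mfps_nth F 0"
  by auto
termination
  by (relation "measure (\<lambda>(F, c). \<Sum>i\<in>UNIV. Poly_Mapping.lookup c i)")
     (auto intro: total_degree_less)

declare mfps_inverse_coeff.simps [simp del]

lemma mfps_unit:
  fixes F :: "('n :: finite, 'k :: field) mfps"
  assumes "mfps_nth F 0 \<noteq> 0"
  shows "\<exists>G. F * G = 1"
proof (intro exI mfps_eqI)
  fix c :: "'n expo"
  let ?t = "\<lambda>p. mfps_nth F (fst p) * mfps_inverse_coeff F (snd p)"
  have D: "{p. fst p + snd p = c} = insert (0, c) {p. fst p + snd p = c \<and> fst p \<noteq> 0}"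
    by (auto simp: prod_eq_iff)
  have fin: "finite {p. fst p + snd p = c \<and> fst p \<noteq> 0}"
    by (rule finite_subset[OF _ finite_expo_decomp'[of c]]) auto
  have "mfps_nth (F * Abs_mfps (mfps_inverse_coeff F)) c
      = ?t (0, c) + (\<Sum>p | fst p + snd p = c \<and> fst p \<noteq> 0. ?t p)"
    unfolding mfps_nth_mult D using fin by simp
  also have "\<dots> = mfps_nth 1 c"
  proof (cases "c = 0")
    case True
    have "{p. fst p + snd p = c \<and> fst p \<noteq> 0} = {}"
      using True by (auto simp: poly_mapping_eq_iff fun_eq_iff lookup_add)
    then have "(\<Sum>p | fst p + snd p = c \<and> fst p \<noteq> 0. ?t p) = 0" by (simp only: sum.empty)
    then show ?thesis
      using True assms mfps_inverse_coeff.simps[of F c] by (simp add: mfps_nth_1)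
  next
    case False
    then show ?thesis
      using assms mfps_inverse_coeff.simps[of F c] by (simp add: mfps_nth_1)
  qed
  finally show "mfps_nth (F * Abs_mfps (mfps_inverse_coeff F)) c = mfps_nth 1 c" .
qed

section \<open>Ideals of finite colength\<close>

lemma mfps_ring_simps [simp]:
  "carrier mfps_ring = UNIV" "x \<oplus>\<^bsub>mfps_ring\<^esub> y = x + y" "x \<otimes>\<^bsub>mfps_ring\<^esub> y = x * y"
  "\<one>\<^bsub>mfps_ring\<^esub> = 1" "\<zero>\<^bsub>mfps_ring\<^esub> = 0"
  for x y :: "('n :: finite, 'k :: comm_ring_1) mfps"
  by (simp_all add: ring_of_type_algebra_def)

text \<open>Translates between the ideals in the definitions of the Milnor and Tjurina numbers and
  the submodules used in the proofs.\<close>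

lemma ideal_mfps_ring_iff:
  fixes I :: "('n :: finite, 'k :: comm_ring_1) mfps set"
  shows "ideal I mfps_ring \<longleftrightarrow> ring_ideal.subspace I"
proof
  interpret R: cring "mfps_ring :: ('n, 'k) mfps ring" by (rule cring_from_type_algebra)
  assume "ideal I mfps_ring"
  then interpret ideal I mfps_ring .
  show "ring_ideal.subspace I"
    using a_closed I_l_closed zero_closed
    by (intro ring_ideal.subspaceI) (metis mfps_ring_simps UNIV_I additive_subgroup.zero_closed is_additive_subgroup)+
next
  interpret R: cring "mfps_ring :: ('n, 'k) mfps ring" by (rule cring_from_type_algebra)
  assume I: "ring_ideal.subspace I"
  have minus: "\<ominus>\<^bsub>mfps_ring\<^esub> a = - a" for a :: "('n, 'k) mfps"
    by (rule R.minus_equality) simp_all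
  show "ideal I mfps_ring"
  proof (rule idealI)
    show "subgroup I (add_monoid mfps_ring)"
    proof (rule subgroup.intro)
      fix x assume "x \<in> I"
      then have "\<ominus>\<^bsub>mfps_ring\<^esub> x \<in> I" using ring_ideal.subspace_neg[OF I] by (simp add: minus)
      then show "inv\<^bsub>add_monoid mfps_ring\<^esub> x \<in> I" unfolding a_inv_def .
    qed (auto simp: ring_ideal.subspace_0[OF I] ring_ideal.subspace_add[OF I])
  next
    show "x \<otimes>\<^bsub>mfps_ring\<^esub> a \<in> I" "a \<otimes>\<^bsub>mfps_ring\<^esub> x \<in> I" if "a \<in> I" for a x
      using ring_ideal.subspace_scale[OF I that, of x] by (simp_all add: mult.commute)
  qed (rule R.ring_axioms)
qed

lemma genideal_mfps_ring: "Idl\<^bsub>mfps_ring\<^esub> S = ring_ideal.span S"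
  for S :: "('n :: finite, 'k :: comm_ring_1) mfps set"
  unfolding genideal_def ideal_mfps_ring_iff ring_ideal.span_def hull_def by (simp add: conj_commute)

section \<open>The quotient as a vector space over the constants\<close>

lemma subfield_mfps_const:
  "subfield (range mfps_const) (mfps_ring :: ('n :: finite, 'k :: field) mfps ring)"
proof -
  let ?h = "mfps_const :: 'k \<Rightarrow> ('n, 'k) mfps"
  interpret K: field "ring_of_type_algebra :: 'k ring" by (rule field_from_type_algebra)
  interpret R: cring "mfps_ring :: ('n, 'k) mfps ring" by (rule cring_from_type_algebra)
  have "?h \<in> ring_hom ring_of_type_algebra mfps_ring"
    by (rule ring_hom_memI)
       (simp_all add: ring_of_type_algebra_def mfps_const_eq mult_single single_add
          flip: mfps_of_mpoly_mult mfps_of_mpoly_add)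
  then interpret h: ring_hom_ring "ring_of_type_algebra :: 'k ring" mfps_ring ?h
    by (intro ring_hom_ringI2 K.ring_axioms R.ring_axioms)
  have "subfield (?h ` carrier ring_of_type_algebra) mfps_ring"
    by (rule h.img_is_subfield(2)[OF K.carrier_is_subfield]) simp
  then show ?thesis by (simp add: ring_of_type_algebra_def)
qed

lemma combine_mfps_ring:
  fixes Ks Us :: "('n :: finite, 'k :: field) mfps list"
  assumes "length Ks = length Us"
  shows "ring.combine mfps_ring Ks Us = (\<Sum>j<length Us. Ks ! j * Us ! j)"
proof -
  interpret R: cring "mfps_ring :: ('n, 'k) mfps ring" by (rule cring_from_type_algebra)
  show ?thesis using assms
    by (induction Ks Us rule: list_induct2) (simp_all add: sum.lessThan_Suc_shift del: sum.lessThan_Suc)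
qed

lemma quotient_coset_eq_zero_iff:
  fixes I :: "('n :: finite, 'k :: field) mfps set"
  assumes "ring_ideal.subspace I"
  shows "I +>\<^bsub>mfps_ring\<^esub> x = \<zero>\<^bsub>mfps_ring Quot I\<^esub> \<longleftrightarrow> x \<in> I"
proof -
  interpret I: ideal I mfps_ring using assms by (simp add: ideal_mfps_ring_iff)
  show ?thesis
    using I.a_rcos_self[of x] I.a_rcos_const[of x] by (auto simp: FactRing_def)
qed

text \<open>In a quotient of dimension n, the n + 1 classes of 1, v, ..., v^n are linearly
  dependent.\<close>

lemma finite_quot_dim_imp_relation:
  fixes I :: "('n :: finite, 'k :: field) mfps set"
  assumes I: "ring_ideal.subspace I" and fin: "mfps_quot_dim I < \<infinity>"
  shows "\<exists>m c. (\<exists>j<m. c j \<noteq> 0) \<and> (\<Sum>j<m. mfps_const (c j) * v ^ j) \<in> I"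
proof (cases "1 \<in> I")
  \<comment> \<open>The quotient is the zero ring, in which the constants do not form a field; the
    relation is 1 itself.\<close>
  case True
  then show ?thesis
    by (intro exI[of _ 1] exI[of _ "\<lambda>_. 1"]) (simp add: mfps_const_eq)
next
  case False
  interpret I: ideal I mfps_ring using I by (simp add: ideal_mfps_ring_iff)
  let ?h = "\<lambda>x. I +>\<^bsub>mfps_ring\<^esub> x"
  let ?Q = "mfps_ring Quot I"
  interpret h: ring_hom_ring mfps_ring ?Q ?h by (rule I.rcos_ring_hom_ring)
  have "\<one>\<^bsub>?Q\<^esub> \<noteq> \<zero>\<^bsub>?Q\<^esub>"
    using False quotient_coset_eq_zero_iff[OF I, of 1] by (simp add: FactRing_def)
  from h.img_is_subfield(2)[OF subfield_mfps_const this]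
  have K: "subfield (?h ` range mfps_const) ?Q" .
  obtain n where n: "h.S.dimension n (?h ` range mfps_const) (carrier ?Q)"
    using fin by (auto simp: mfps_quot_dim_def Let_def h.S.finite_dimension_def image_image split: if_splits)
  define Us where "Us = map (\<lambda>j. v ^ j) [0..<Suc n]"
  have Us: "set (map ?h Us) \<subseteq> carrier ?Q" using h.hom_closed by auto
  have "h.S.dependent (?h ` range mfps_const) (map ?h Us)"
    using h.S.independent_length_le_dimension[OF K n _ Us] by (auto simp: Us_def)
  then obtain Ks where Ks: "length Ks = length (map ?h Us)" "h.S.combine Ks (map ?h Us) = \<zero>\<^bsub>?Q\<^esub>"
    "set Ks \<subseteq> ?h ` range mfps_const" "set Ks \<noteq> {\<zero>\<^bsub>?Q\<^esub>}"
    using h.S.dependent_imp_non_trivial_combine[OF K Us] by metis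
  have "\<forall>k\<in>set Ks. \<exists>c. k = ?h (mfps_const c)" using Ks(3) by blast
  then obtain C where C: "\<And>k. k \<in> set Ks \<Longrightarrow> k = ?h (mfps_const (C k))" by metis
  define cs where "cs = map C Ks"
  have Ks_eq: "Ks = map ?h (map mfps_const cs)"
    using C by (auto simp: cs_def intro!: map_idI[symmetric])
  have len: "length cs = Suc n" using Ks(1) by (simp add: cs_def Us_def)
  have "h.S.combine Ks (map ?h Us) = ?h (ring.combine mfps_ring (map mfps_const cs) Us)"
    unfolding Ks_eq by (rule h.combine_hom) auto
  then have "ring.combine mfps_ring (map mfps_const cs) Us \<in> I"
    using Ks(2) quotient_coset_eq_zero_iff[OF I] by metis
  also have "ring.combine mfps_ring (map mfps_const cs) Us = (\<Sum>j<Suc n. mfps_const (cs ! j) * v ^ j)"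
    using len by (subst combine_mfps_ring) (auto simp: Us_def nth_append intro!: sum.cong simp del: upt_Suc)
  finally have "(\<Sum>j<Suc n. mfps_const (cs ! j) * v ^ j) \<in> I" .
  moreover have "\<exists>j<Suc n. cs ! j \<noteq> 0"
  proof (rule ccontr)
    assume *: "\<not> ?thesis"
    have "k = \<zero>\<^bsub>?Q\<^esub>" if "k \<in> set Ks" for k
    proof -
      obtain j where "j < Suc n" "k = ?h (mfps_const (cs ! j))"
        using \<open>k \<in> set Ks\<close> len unfolding Ks_eq by (auto simp: in_set_conv_nth)
      then show ?thesis
        using * quotient_coset_eq_zero_iff[OF I, of 0] ring_ideal.subspace_0[OF I] by auto
    qed
    moreover have "Ks \<noteq> []" using len by (auto simp: cs_def)
    ultimately have "set Ks = {\<zero>\<^bsub>?Q\<^esub>}" by (metis set_empty subset_singletonD subsetI singletonI)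
    then show False using Ks(4) by simp
  qed
  ultimately show ?thesis by (intro exI[of _ "Suc n"] exI[of _ "\<lambda>j. cs ! j"]) blast
qed

lemma finite_quot_dimI:
  fixes I :: "('n :: finite, 'k :: field) mfps set"
  assumes I: "ring_ideal.subspace I"
    and span: "\<And>F. \<exists>c. F - (\<Sum>j<length Us. mfps_const (c j) * Us ! j) \<in> I"
  shows "mfps_quot_dim I < \<infinity>"
proof -
  interpret I: ideal I mfps_ring using I by (simp add: ideal_mfps_ring_iff)
  let ?h = "\<lambda>x. I +>\<^bsub>mfps_ring\<^esub> x"
  let ?Q = "mfps_ring Quot I"
  interpret h: ring_hom_ring mfps_ring ?Q ?h by (rule I.rcos_ring_hom_ring)
  have carrier: "carrier ?Q = range ?h"
    by (auto simp: FactRing_def A_RCOSETS_def' )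
  have "h.S.finite_dimension (?h ` range mfps_const) (carrier ?Q)"
  proof (cases "1 \<in> I")
    case True
    have "x \<in> I" for x using ring_ideal.subspace_scale[OF I True, of x] by simp
    then have "carrier ?Q = {\<zero>\<^bsub>?Q\<^esub>}"
      using quotient_coset_eq_zero_iff[OF I] unfolding carrier by auto
    then show ?thesis using h.S.finite_dimensionI[OF h.S.dimension.zero_dim] by simp
  next
    case False
    then have "\<one>\<^bsub>?Q\<^esub> \<noteq> \<zero>\<^bsub>?Q\<^esub>"
      using quotient_coset_eq_zero_iff[OF I, of 1] by (simp add: FactRing_def)
    from h.img_is_subfield(2)[OF subfield_mfps_const this]
    have K: "subfield (?h ` range mfps_const) ?Q" .
    have Us: "set (map ?h Us) \<subseteq> carrier ?Q" using h.hom_closed by auto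
    have "y \<in> h.S.Span (?h ` range mfps_const) (map ?h Us)" if "y \<in> carrier ?Q" for y
    proof -
      obtain F where F: "y = ?h F" using \<open>y \<in> carrier ?Q\<close> carrier by auto
      obtain c where c: "F - (\<Sum>j<length Us. mfps_const (c j) * Us ! j) \<in> I" using span by blast
      define Ks where "Ks = map (\<lambda>j. mfps_const (c j) :: ('n, 'k) mfps) [0..<length Us]"
      define T where "T = (\<Sum>j<length Us. mfps_const (c j) * Us ! j)"
      have "ring.combine mfps_ring Ks Us = T"
        by (subst combine_mfps_ring) (auto simp: Ks_def T_def)
      then have "h.S.combine (map ?h Ks) (map ?h Us) = ?h T"
        by (subst h.combine_hom) auto
      moreover have "?h T = y"
      proof -
        have "F = (F - T) \<oplus>\<^bsub>mfps_ring\<^esub> T" by simp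
        then have "?h F = ?h (F - T) \<oplus>\<^bsub>?Q\<^esub> ?h T"
          by (metis h.hom_add mfps_ring_simps(1) UNIV_I)
        moreover have "?h (F - T) = \<zero>\<^bsub>?Q\<^esub>"
          using c quotient_coset_eq_zero_iff[OF I] by (simp add: T_def)
        ultimately show ?thesis using F h.hom_closed[of T] by simp
      qed
      moreover have "set (map ?h Ks) \<subseteq> ?h ` range mfps_const" by (auto simp: Ks_def)
      ultimately show ?thesis
        unfolding h.S.Span_eq_combine_set[OF K Us] by blast
    qed
    then have "carrier ?Q = h.S.Span (?h ` range mfps_const) (map ?h Us)"
      using h.S.Span_subgroup_props(1)[OF K Us] by blast
    then show ?thesis using h.S.Span_finite_dimension[OF K Us] by simp
  qed
  then show ?thesis by (simp add: mfps_quot_dim_def Let_def image_image)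
qed

lemma power_mem_ideal_mono:
  "ring_ideal.subspace I \<Longrightarrow> x ^ r \<in> I \<Longrightarrow> r \<le> s \<Longrightarrow> x ^ s \<in> I"
  using ring_ideal.subspace_scale[of I "x ^ r" "x ^ (s - r)"] by (simp flip: power_add)

text \<open>The powers of each variable satisfy a linear relation modulo \<open>I\<close>; factoring
  out the lowest power leaves a unit, so this power lies in \<open>I\<close>. Conversely, the
  monomials with all exponents below \<open>r\<close> span the quotient.\<close>

lemma finite_quot_dim_iff:
  fixes I :: "('n :: finite, 'k :: field) mfps set"
  assumes I: "ring_ideal.subspace I"
  shows "mfps_quot_dim I < \<infinity> \<longleftrightarrow> (\<exists>r. \<forall>i. mfps_var i ^ r \<in> I)"
proof
  assume fin: "mfps_quot_dim I < \<infinity>"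
  have "\<exists>r. mfps_var i ^ r \<in> I" for i
  proof -
    obtain m c where c: "\<exists>j<m. c j \<noteq> 0" "(\<Sum>j<m. mfps_const (c j) * mfps_var i ^ j) \<in> I"
      using finite_quot_dim_imp_relation[OF I fin, of "mfps_var i"] by blast
    define r where "r = (LEAST j. j < m \<and> c j \<noteq> 0)"
    have r: "r < m" "c r \<noteq> 0" using LeastI_ex[OF c(1)] by (simp_all add: r_def)
    have least: "c j = 0" if "j < r" for j
      using not_less_Least[OF that[unfolded r_def]] that r by auto
    \<comment> \<open>The relation divided by the lowest power; its constant term is
      \<open>c r\<close>.\<close>
    define U where "U = (\<Sum>j\<in>{r..<m}. mfps_const (c j) * mfps_var i ^ (j - r))"
    have "(\<Sum>j<m. mfps_const (c j) * mfps_var i ^ j) = (\<Sum>j\<in>{r..<m}. mfps_const (c j) * mfps_var i ^ j)"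
      using least by (intro sum.mono_neutral_right) auto
    also have "\<dots> = mfps_var i ^ r * U"
      unfolding U_def sum_distrib_left
      by (intro sum.cong) (auto simp: mult_ac simp flip: power_add)
    finally have "mfps_var i ^ r * U \<in> I" using c by simp
    moreover have "mfps_nth U 0 = (\<Sum>j\<in>{r..<m}. if j = r then c r else 0)"
      unfolding U_def mfps_nth_sum
    proof (rule sum.cong)
      fix j assume j: "j \<in> {r..<m}"
      have "mfps_nth (mfps_var i ^ (j - r) * mfps_const (c j)) 0 = (if j = r then c r else 0)"
        using j by (subst mfps_nth_var_power_mult) (auto simp: mfps_const_def)
      then show "mfps_nth (mfps_const (c j) * mfps_var i ^ (j - r)) 0 = (if j = r then c r else 0)"
        by (simp add: mult.commute)
    qed simp
    then have "mfps_nth U 0 \<noteq> 0" using r by simp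
    then obtain V where "U * V = 1" using mfps_unit by blast
    then have "mfps_var i ^ r = V * (mfps_var i ^ r * U)"
      by (metis mult.commute mult.left_commute mult.right_neutral)
    ultimately show ?thesis using ring_ideal.subspace_scale[OF I] by metis
  qed
  then obtain r where r: "\<And>i. mfps_var i ^ r i \<in> I" by metis
  have "mfps_var i ^ Max (range r) \<in> I" for i
    by (rule power_mem_ideal_mono[OF I r]) simp
  then show "\<exists>r. \<forall>i. mfps_var i ^ r \<in> I" by blast
next
  assume "\<exists>r. \<forall>i. mfps_var i ^ r \<in> I"
  then obtain r where r: "\<And>i. mfps_var i ^ r \<in> I" by blast
  let ?B = "{a :: 'n expo. \<forall>i. Poly_Mapping.lookup a i < r}"
  obtain as where as: "set as = ?B" "distinct as"
    using finite_distinct_list[OF finite_expo_box] by blast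
  show "mfps_quot_dim I < \<infinity>"
  proof (rule finite_quot_dimI[OF I, where Us = "map (\<lambda>a. mfps_of_mpoly (Poly_Mapping.single a 1)) as"])
    fix F :: "('n, 'k) mfps"
    let ?mon = "\<lambda>a. mfps_of_mpoly (Poly_Mapping.single a 1)"
    \<comment> \<open>The part of \<open>F\<close> with all exponents below \<open>r\<close>; each
      remaining term is divisible by some X_i^r.\<close>
    define T where "T = (\<Sum>a\<in>?B. mfps_const (mfps_nth F a) * ?mon a)"
    have T_nth: "mfps_nth T b = (if b \<in> ?B then mfps_nth F b else 0)" for b
    proof -
      have "mfps_nth T b = (\<Sum>a\<in>?B. if a = b then mfps_nth F b else 0)"
        unfolding T_def mfps_nth_sum
        by (rule sum.cong) (auto simp: mfps_const_eq mult_single lookup_single when_def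
            simp flip: mfps_of_mpoly_mult)
      then show ?thesis unfolding sum.delta[OF finite_expo_box] .
    qed
    have "\<exists>i. r \<le> Poly_Mapping.lookup a i" if "mfps_nth (F - T) a \<noteq> 0" for a
      using that by (auto simp: T_nth not_less split: if_splits)
    then obtain G where "F - T = (\<Sum>i\<in>UNIV. mfps_var i ^ r * G i)"
      using mfps_high_order_terms by blast
    also have "\<dots> \<in> I"
      using ring_ideal.subspace_scale[OF I r]
      by (intro ring_ideal.subspace_sum[OF I]) (simp add: mult.commute)
    finally have "F - T \<in> I" .
    moreover have "T = (\<Sum>j<length as. mfps_const (mfps_nth F (as ! j)) * ?mon (as ! j))"
      unfolding T_def as(1)[symmetric] using as(2)
      by (simp add: sum.distinct_set_conv_list sum_list_sum_nth atLeast0LessThan)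
    ultimately show "\<exists>c. F - (\<Sum>j<length (map ?mon as). mfps_const (c j) * map ?mon as ! j) \<in> I"
      by (intro exI[of _ "\<lambda>j. mfps_nth F (as ! j)"]) simp
  qed
qed

section \<open>Local smoothings\<close>

lemma ring_ideal_span_range:
  fixes F :: "'n :: finite \<Rightarrow> 'a :: comm_ring_1"
  assumes "x \<in> ring_ideal.span (range F)"
  shows "\<exists>G. x = (\<Sum>i\<in>UNIV. G i * F i)"
proof -
  have "ring_ideal.subspace {x. \<exists>G. x = (\<Sum>i\<in>UNIV. G i * F i)}" (is "ring_ideal.subspace ?S")
  proof (rule ring_ideal.subspaceI)
    show "0 \<in> ?S" by (auto intro: exI[of _ "\<lambda>_. 0"])
    show "x + y \<in> ?S" if xy: "x \<in> ?S" "y \<in> ?S" for x y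
    proof -
      obtain G H where "x = (\<Sum>i\<in>UNIV. G i * F i)" "y = (\<Sum>i\<in>UNIV. H i * F i)" using xy by blast
      then have "x + y = (\<Sum>i\<in>UNIV. (G i + H i) * F i)" by (simp add: distrib_right sum.distrib)
      then show ?thesis by (intro CollectI exI[of _ "\<lambda>i. G i + H i"])
    qed
    show "c * x \<in> ?S" if x: "x \<in> ?S" for c x
    proof -
      obtain G where "x = (\<Sum>i\<in>UNIV. G i * F i)" using x by blast
      then have "c * x = (\<Sum>i\<in>UNIV. (c * G i) * F i)" by (simp add: sum_distrib_left mult.assoc)
      then show ?thesis by (intro CollectI exI[of _ "\<lambda>i. c * G i"])
    qed
  qed
  moreover have "range F \<subseteq> {x. \<exists>G. x = (\<Sum>i\<in>UNIV. G i * F i)}"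
  proof clarsimp
    fix j
    have "F j = (\<Sum>i\<in>UNIV. (if i = j then 1 else 0) * F i)"
      by (simp add: if_distrib[of "\<lambda>c. c * _"] cong: if_cong)
    then show "\<exists>G. F j = (\<Sum>i\<in>UNIV. G i * F i)" by (rule exI[of _ "\<lambda>i. if i = j then 1 else 0"])
  qed
  ultimately show ?thesis using ring_ideal.span_minimal assms by blast
qed

lemma jacobian_ideal_eq:
  "jacobian_ideal (mfps_of_mpoly f) = ring_ideal.span (range (\<lambda>i. mfps_of_mpoly (mpoly_deriv i f)))"
  by (simp add: jacobian_ideal_def genideal_mfps_ring mfps_of_mpoly_deriv)

lemma mfps_of_mpoly_span:
  "p \<in> ring_ideal.span S \<Longrightarrow> mfps_of_mpoly p \<in> ring_ideal.span (mfps_of_mpoly ` S)"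
proof (induction rule: ring_ideal.span_induct_alt)
  case base
  then show ?case by (simp add: ring_ideal.span_zero)
next
  case (step c x y)
  then show ?case
    by (auto simp: mfps_of_mpoly_add mfps_of_mpoly_mult
        intro!: ring_ideal.span_add ring_ideal.span_scale intro: ring_ideal.span_base)
qed

lemma mpoly_eval_span_zero:
  fixes x :: "'n :: finite \<Rightarrow> 'k :: field"
  shows "p \<in> ring_ideal.span S \<Longrightarrow> \<forall>q\<in>S. mpoly_eval x q = 0 \<Longrightarrow> mpoly_eval x p = 0"
  by (induction rule: ring_ideal.span_induct_alt) (auto simp: mpoly_eval_add mpoly_eval_mult)

lemma mpoly_eval_origin: "mpoly_eval (\<lambda>_. 0) p = Poly_Mapping.lookup p 0"
  for p :: "('n :: finite, 'k :: comm_ring_1) mpoly"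
proof -
  have "(\<Prod>i\<in>UNIV. (0 :: 'k) ^ Poly_Mapping.lookup a i) = (if a = 0 then 1 else 0)" for a :: "'n expo"
  proof (cases "a = 0")
    case False
    then obtain i where "Poly_Mapping.lookup a i \<noteq> 0" by (auto simp: poly_mapping_eq_iff fun_eq_iff)
    then show ?thesis using False by (intro trans[OF prod_zero]) (auto simp: zero_power intro!: exI[of _ i])
  qed simp
  then have "mpoly_eval (\<lambda>_. 0) p
      = (\<Sum>a\<in>insert 0 (Poly_Mapping.keys p). Poly_Mapping.lookup p a * (if a = 0 then 1 else 0))"
    by (subst mpoly_eval_superset[of "insert 0 (Poly_Mapping.keys p)"]) auto
  also have "\<dots> = (\<Sum>a\<in>insert 0 (Poly_Mapping.keys p). if a = 0 then Poly_Mapping.lookup p 0 else 0)"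
    by (rule sum.cong) auto
  finally show ?thesis by (simp only: sum.delta finite_insert finite_keys insertI1 if_True)
qed

text \<open>
  The powers of the variables lie in the Jacobian ideal of the power series ring; truncation and
  Nakayama's lemma bring this back to the polynomial ring, up to a factor that does not vanish
  at the origin.
\<close>

lemma local_membership_of_powers:
  fixes F :: "'n :: finite \<Rightarrow> ('n, 'k :: field) mpoly"
  assumes "\<And>i. mfps_var i ^ r \<in> ring_ideal.span (range (\<lambda>j. mfps_of_mpoly (F j)))"
  shows "\<exists>h. Poly_Mapping.lookup h 0 = 0 \<and> (\<forall>i. (1 - h) * mpoly_var i ^ r \<in> ring_ideal.span (range F))"
proof -
  let ?m = "{p :: ('n, 'k) mpoly. Poly_Mapping.lookup p 0 = 0}"
  let ?J = "ring_ideal.span (range F)"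
  \<comment> \<open>The box includes the exponent \<open>r\<close>, so that truncation leaves only
    terms with some exponent strictly above \<open>r\<close>.\<close>
  let ?B = "{a :: 'n expo. \<forall>i. Poly_Mapping.lookup a i < Suc r}"
  have m: "ring_ideal.subspace ?m"
  proof (rule ring_ideal.subspaceI)
    show "c * x \<in> ?m" if "x \<in> ?m" for c x
      using that mfps_mult_nth_0[of "mfps_of_mpoly c" "mfps_of_mpoly x"]
      by (simp flip: mfps_of_mpoly_mult)
  qed (auto simp: lookup_add)
  have "\<exists>l. (\<forall>j\<in>UNIV. l j \<in> ?m) \<and> mpoly_var i ^ r - (\<Sum>j\<in>UNIV. l j * mpoly_var j ^ r) \<in> ?J" for i
  proof -
    obtain G where G: "mfps_var i ^ r = (\<Sum>j\<in>UNIV. G j * mfps_of_mpoly (F j))"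
      using ring_ideal_span_range[OF assms, of i] by blast
    define tr where "tr j = (\<Sum>a\<in>?B. Poly_Mapping.single a (mfps_nth (G j) a))" for j
    have tr: "Poly_Mapping.lookup (tr j) a = mfps_nth (G j) a" if "a \<in> ?B" for j a
    proof -
      have "Poly_Mapping.lookup (tr j) a = (\<Sum>b\<in>?B. if b = a then mfps_nth (G j) a else 0)"
        unfolding tr_def lookup_sum by (rule sum.cong) (auto simp: lookup_single when_def)
      then show ?thesis unfolding sum.delta[OF finite_expo_box] using that by simp
    qed
    \<comment> \<open>The error made by truncating the coefficients in the relation for
      X_i^r.\<close>
    define p where "p = mpoly_var i ^ r - (\<Sum>j\<in>UNIV. tr j * F j)"
    have p_eq: "mfps_of_mpoly p = (\<Sum>j\<in>UNIV. (G j - mfps_of_mpoly (tr j)) * mfps_of_mpoly (F j))"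
      by (simp add: p_def mfps_of_mpoly_diff mfps_of_mpoly_power mfps_of_mpoly_sum mfps_of_mpoly_mult
          left_diff_distrib sum_subtractf flip: mfps_var_def G)
    have "\<exists>k. r < Poly_Mapping.lookup c k" if c: "c \<in> Poly_Mapping.keys p" for c
    proof (rule ccontr)
      assume small: "\<nexists>k. r < Poly_Mapping.lookup c k"
      \<comment> \<open>A coefficient inside the box involves \<open>G j\<close> only at exponents
        inside the box, where it agrees with its truncation.\<close>
      have "mfps_nth ((G j - mfps_of_mpoly (tr j)) * mfps_of_mpoly (F j)) c = 0" for j
        unfolding mfps_nth_mult
      proof (rule sum.neutral, clarify)
        fix a b assume ab: "c = fst (a, b) + snd (a, b)"
        have "a \<in> ?B"
        proof clarify
          fix k
          have "\<not> r < Poly_Mapping.lookup a k + Poly_Mapping.lookup b k"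
            using small ab by (auto simp: lookup_add)
          then show "Poly_Mapping.lookup a k < Suc r" by simp
        qed
        then show "mfps_nth (G j - mfps_of_mpoly (tr j)) (fst (a, b))
            * mfps_nth (mfps_of_mpoly (F j)) (snd (a, b)) = 0"
          using tr[of a j] by simp
      qed
      then have "mfps_nth (mfps_of_mpoly p) c = 0" by (simp only: p_eq mfps_nth_sum sum.neutral_const)
      then show False using c by (simp add: in_keys_iff)
    qed
    then obtain l where l: "\<And>j. Poly_Mapping.lookup (l j) 0 = 0" "p = (\<Sum>j\<in>UNIV. l j * mpoly_var j ^ r)"
      using mpoly_high_order_terms[of p r] by blast
    have "mpoly_var i ^ r - (\<Sum>j\<in>UNIV. l j * mpoly_var j ^ r) = (\<Sum>j\<in>UNIV. tr j * F j)"
      by (simp add: p_def flip: l(2))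
    also have "\<dots> \<in> ?J"
      by (intro ring_ideal.span_sum ring_ideal.span_scale ring_ideal.span_base) simp
    finally show ?thesis using l(1) by blast
  qed
  then show ?thesis
    using nakayama_elimination[OF finite_UNIV m ring_ideal.subspace_span[of "range F"],
        of "\<lambda>i. mpoly_var i ^ r"] by blast
qed

lemma local_smoothing_if_finite_milnor_number:
  fixes f :: "('n :: finite, 'k :: field) mpoly"
  assumes f0: "Poly_Mapping.lookup f 0 = 0" and mu: "milnor_number (mfps_of_mpoly f) < \<infinity>"
  shows "local_smoothing f"
proof -
  let ?F = "\<lambda>i. mpoly_deriv i f"
  obtain r where "\<And>i. mfps_var i ^ r \<in> jacobian_ideal (mfps_of_mpoly f)"
    using mu finite_quot_dim_iff[of "jacobian_ideal (mfps_of_mpoly f)"]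
    by (auto simp: milnor_number_def jacobian_ideal_eq)
  then obtain h where h: "Poly_Mapping.lookup h 0 = 0"
    "\<And>i. (1 - h) * mpoly_var i ^ r \<in> ring_ideal.span (range ?F)"
    using local_membership_of_powers[of r ?F] by (auto simp: jacobian_ideal_eq)
  define U where "U = {x. mpoly_eval x (1 - h) \<noteq> 0}"
  have "zariski_open U"
    unfolding zariski_open_def zariski_closed_def U_def by (intro exI[of _ "{1 - h}"]) auto
  moreover have "(\<lambda>_. 0) \<in> U" using h(1) by (simp add: U_def mpoly_eval_origin lookup_minus)
  moreover have "\<not> singular_on_fiber f s x" if s: "s \<noteq> 0" and x: "x \<in> U" for s x
  proof
    assume sing: "singular_on_fiber f s x"
    have "x i = 0" for i
    proof -
      have "mpoly_eval x ((1 - h) * mpoly_var i ^ r) = 0"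
        using sing by (intro mpoly_eval_span_zero[OF h(2)]) (auto simp: singular_on_fiber_def)
      \<comment> \<open>For \<open>r = 0\<close> this is already absurd; otherwise it forces the
        coordinate to vanish.\<close>
      then have "x i ^ r = 0" using x by (simp add: U_def mpoly_eval_mult mpoly_eval.ev_power)
      then show ?thesis by simp
    qed
    then have "x = (\<lambda>_. 0)" by auto
    \<comment> \<open>The origin lies on the fiber over f(0) = 0, while \<open>s\<close> is
      nonzero.\<close>
    then show False
      using sing s f0 by (simp add: singular_on_fiber_def mpoly_fiber_def mpoly_eval_origin)
  qed
  ultimately show ?thesis unfolding local_smoothing_def by blast
qed

text \<open>Modulo \<open>J\<close>, the element \<open>x\<close> is congruent to u f, so its n-th
  power is congruent to u^n f^n, which lies in \<open>J\<close>.\<close>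

lemma power_mem_sum_ideal:
  fixes J :: "'a :: comm_ring_1 set"
  assumes J: "ring_ideal.subspace J" and x: "x - u * f \<in> J" and f: "f ^ n \<in> J"
  shows "x ^ n \<in> J"
proof -
  have "x ^ n - (u * f) ^ n \<in> J"
  proof (induction n)
    case (Suc n)
    have "x ^ Suc n - (u * f) ^ Suc n = x * (x ^ n - (u * f) ^ n) + (u * f) ^ n * (x - u * f)"
      by (simp add: algebra_simps)
    also have "\<dots> \<in> J"
      by (intro ring_ideal.subspace_add[OF J] ring_ideal.subspace_scale[OF J] Suc x)
    finally show ?case .
  qed (simp add: ring_ideal.subspace_0[OF J])
  moreover have "(u * f) ^ n \<in> J"
    using ring_ideal.subspace_scale[OF J f] by (simp add: power_mult_distrib)
  ultimately show ?thesis using ring_ideal.subspace_add[OF J] by fastforce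
qed

lemma finite_milnor_number_if_local_smoothing:
  fixes f :: "('n :: finite, 'k :: alg_closed_field) mpoly"
  assumes smoothing: "local_smoothing f" and tau: "tjurina_number (mfps_of_mpoly f) < \<infinity>"
  shows "milnor_number (mfps_of_mpoly f) < \<infinity>"
proof -
  let ?f = "mfps_of_mpoly f" and ?D = "range (\<lambda>i. mpoly_deriv i f)"
  let ?J = "jacobian_ideal ?f"
  have J: "ring_ideal.subspace ?J" by (simp add: jacobian_ideal_eq)
  obtain U where U: "zariski_open U" "(\<lambda>_. 0) \<in> U"
    "\<And>s x. s \<noteq> 0 \<Longrightarrow> x \<in> mpoly_fiber f s \<Longrightarrow> x \<in> U \<Longrightarrow> \<not> singular_on_fiber f s x"
    using smoothing unfolding local_smoothing_def by blast
  obtain S where S: "- U = {x. \<forall>p\<in>S. mpoly_eval x p = 0}"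
    using U(1) by (auto simp: zariski_open_def zariski_closed_def)
  obtain h where h: "h \<in> S" "mpoly_eval (\<lambda>_. 0) h \<noteq> 0" using U(2) S by blast
  have "\<exists>n. (h * f) ^ n \<in> ring_ideal.span ?D"
  proof (rule nullstellensatz[OF ring_ideal.subspace_span])
    fix x :: "'n \<Rightarrow> 'k"
    assume x: "\<And>p. p \<in> ring_ideal.span ?D \<Longrightarrow> mpoly_eval x p = 0"
    \<comment> \<open>A common zero of the partial derivatives at which \<open>h\<close> does not
      vanish lies in \<open>U\<close>. If \<open>f\<close> were nonzero there, it would be a
      singular point of a fiber over a nonzero value.\<close>
    have "mpoly_eval x f = 0" if "mpoly_eval x h \<noteq> 0"
    proof (rule ccontr)
      assume "mpoly_eval x f \<noteq> 0"
      moreover have "x \<in> U" using that h(1) S by blast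
      ultimately have "\<not> singular_on_fiber f (mpoly_eval x f) x"
        using U(3) by (simp add: mpoly_fiber_def)
      then show False
        using x ring_ideal.span_base[of _ ?D] by (auto simp: singular_on_fiber_def mpoly_fiber_def)
    qed
    then show "mpoly_eval x (h * f) = 0" by (auto simp: mpoly_eval_mult)
  qed
  then obtain n where n: "(h * f) ^ n \<in> ring_ideal.span ?D" by blast
  \<comment> \<open>As \<open>h\<close> does not vanish at the origin, it is a unit among power
    series and can be cancelled.\<close>
  obtain V where V: "mfps_of_mpoly h * V = 1"
    using mfps_unit[of "mfps_of_mpoly h"] h(2) by (auto simp: mpoly_eval_origin)
  have "mfps_of_mpoly ((h * f) ^ n) \<in> ?J"
    using mfps_of_mpoly_span[OF n] by (simp add: jacobian_ideal_eq image_image)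
  then have "V ^ n * (mfps_of_mpoly h ^ n * ?f ^ n) \<in> ?J"
    using ring_ideal.subspace_scale[OF J] by (simp add: mfps_of_mpoly_power mfps_of_mpoly_mult power_mult_distrib)
  moreover have "V ^ n * (mfps_of_mpoly h ^ n * ?f ^ n) = (mfps_of_mpoly h * V) ^ n * ?f ^ n"
    by (simp add: power_mult_distrib mult_ac)
  ultimately have fn: "?f ^ n \<in> ?J" by (simp add: V)
  let ?T = "(PIdl\<^bsub>mfps_ring\<^esub> ?f) <+>\<^bsub>mfps_ring\<^esub> ?J"
  have T_iff: "x \<in> ?T \<longleftrightarrow> (\<exists>u. x - u * ?f \<in> ?J)" for x
  proof -
    have "x \<in> ?T \<longleftrightarrow> (\<exists>u. \<exists>j\<in>?J. x = u * ?f + j)"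
      by (auto simp: set_add_def' cgenideal_def)
    also have "\<dots> \<longleftrightarrow> (\<exists>u. x - u * ?f \<in> ?J)"
      by (metis add_diff_cancel_left' diff_add_cancel add.commute)
    finally show ?thesis .
  qed
  have T: "ring_ideal.subspace ?T"
  proof (rule ring_ideal.subspaceI; unfold T_iff)
    show "\<exists>u. 0 - u * ?f \<in> ?J" using ring_ideal.subspace_0[OF J] by (intro exI[of _ 0]) simp
  next
    fix x y assume "\<exists>u. x - u * ?f \<in> ?J" "\<exists>u. y - u * ?f \<in> ?J"
    then obtain u v where "x - u * ?f \<in> ?J" "y - v * ?f \<in> ?J" by blast
    from ring_ideal.subspace_add[OF J this]
    show "\<exists>u. x + y - u * ?f \<in> ?J" by (intro exI[of _ "u + v"]) (simp add: algebra_simps)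
  next
    fix c x assume "\<exists>u. x - u * ?f \<in> ?J"
    then obtain u where "x - u * ?f \<in> ?J" by blast
    from ring_ideal.subspace_scale[OF J this, of c]
    show "\<exists>u. c * x - u * ?f \<in> ?J" by (intro exI[of _ "c * u"]) (simp add: algebra_simps)
  qed
  obtain r where r: "\<And>i. mfps_var i ^ r \<in> ?T"
    using tau finite_quot_dim_iff[OF T] by (auto simp: tjurina_number_def)
  \<comment> \<open>The power with exponent \<open>r\<close> is congruent to a multiple of
    \<open>f\<close> modulo \<open>?J\<close>, and the n-th power of \<open>f\<close> lies in
    \<open>?J\<close>.\<close>
  have "mfps_var i ^ (r * n) \<in> ?J" for i
    using r[of i] power_mem_sum_ideal[OF J _ fn] unfolding T_iff power_mult by blast
  then show ?thesis
    unfolding milnor_number_def finite_quot_dim_iff[OF J] by blast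
qed

theorem theorem4p2:
  fixes f :: "('n :: finite, 'k :: alg_closed_field) mpoly"
  assumes "isolated_singularity_at_origin f"
  shows "local_smoothing f \<longleftrightarrow> milnor_number (mfps_of_mpoly f) < \<infinity>"
proof
  assume "local_smoothing f"
  then show "milnor_number (mfps_of_mpoly f) < \<infinity>"
    using assms finite_milnor_number_if_local_smoothing
    by (auto simp: isolated_singularity_at_origin_def)
next
  assume mu: "milnor_number (mfps_of_mpoly f) < \<infinity>"
  have "ideal (mfps_maximal_ideal :: ('n, 'k) mfps set) mfps_ring"
    using maximalideal_mfps_maximal_ideal by (rule maximalideal.axioms(1))
  \<comment> \<open>The square of the maximal ideal is contained in it, so \<open>f\<close> vanishes
    at the origin.\<close>
  then have "mfps_of_mpoly f \<in> mfps_maximal_ideal"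
    using assms ring.ideal_prod_inter[OF ring_from_type_algebra]
    by (auto simp: isolated_singularity_at_origin_def)
  then have "Poly_Mapping.lookup f 0 = 0" by (simp add: mfps_maximal_ideal_def)
  then show "local_smoothing f" using local_smoothing_if_finite_milnor_number mu by blast
qed

end
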